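(* Let $\Gamma,\Delta$ be two countable groups and consider free, measure preserving actions of $\Gamma,\Delta$ on a standard probability space $(X,\mu)$ with associated equivalence relations $E=E^X_\Delta\subseteq F=E^X_\Gamma$. If there are $S,S'\in[F]$ such that $\inf_{\gamma\in\Gamma}\varphi_E(S\gamma S')>0$, then $\Gamma,\Delta$ are measure equivalent.
   Context: Everything is modulo null sets. $E^X_\Gamma$ is the orbit equivalence relation of an action of $\Gamma$ on $X$; $\gamma\in\Gamma$ also denotes the automorphism $x\mapsto\gamma\cdot x$ of $(X,\mu)$. $\mathrm{Aut}(X,\mu)$ is the group of measure preserving Borel automorphisms (modulo a.e. equality); $[F]=\{T\in\mathrm{Aut}(X,\mu):T(x)\,F\,x\ \mu\text{-a.e.}\}$; $\varphi_E(S)=\mu(\{x:S(x)\,E\,x\})$ for $S\in\mathrm{Aut}(X,\mu)$. Two countable groups $\Gamma,\Delta$ are measure equivalent (ME) if there are commuting, free, measure preserving Borel actions of $\Gamma$ and $\Delta$ on a non-zero standard $\sigma$-finite measure space such that each of the two actions admits a Borel fundamental domain (transversal) of finite measure. *)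

theory Defs
  imports "HOL-Analysis.Analysis" "HOL-Probability.Probability_Measure" "HOL-Algebra.Group_Action"
begin

definition standard_borel :: "'a measure \<Rightarrow> bool" where
  "standard_borel M \<longleftrightarrow>
     (\<exists>T. topspace T = space M \<and> completely_metrizable_space T \<and> separable_space T \<and>
          sets M = sigma_sets (space M) {U. openin T U})"

text \<open>Elements of the automorphism group are represented by functions; classes modulo
  a.e. equality are not formed, and all notions below that take an automorphism as an argument
  depend only on its a.e. class.\<close>

definition aut :: "'a measure \<Rightarrow> ('a \<Rightarrow> 'a) set" where
  "aut M = {T. bij_betw T (space M) (space M) \<and>
               T \<in> measurable M M \<and> inv_into (space M) T \<in> measurable M M \<and>
               (\<forall>A \<in> sets M. emeasure M (T -` A \<inter> space M) = emeasure M A)}"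

text \<open>Actions obey the action laws at every point; freeness, inclusion of equivalence relations
  and the transversal property are understood modulo null sets.\<close>

definition mp_action :: "('g, 'm) monoid_scheme \<Rightarrow> 'a measure \<Rightarrow> ('g \<Rightarrow> 'a \<Rightarrow> 'a) \<Rightarrow> bool" where
  "mp_action G M a \<longleftrightarrow> group_action G (space M) a \<and> (\<forall>g \<in> carrier G. a g \<in> aut M)"

definition free_action :: "('g, 'm) monoid_scheme \<Rightarrow> 'a measure \<Rightarrow> ('g \<Rightarrow> 'a \<Rightarrow> 'a) \<Rightarrow> bool" where
  "free_action G M a \<longleftrightarrow> (AE x in M. stabilizer G a x = {\<one>\<^bsub>G\<^esub>})"

definition orbit_rel :: "('g, 'm) monoid_scheme \<Rightarrow> 'a measure \<Rightarrow> ('g \<Rightarrow> 'a \<Rightarrow> 'a) \<Rightarrow> 'a rel" where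
  "orbit_rel G M a = {(x, y). x \<in> space M \<and> y \<in> orbit G a x}"

definition ae_subrel :: "'a measure \<Rightarrow> 'a rel \<Rightarrow> 'a rel \<Rightarrow> bool" where
  "ae_subrel M E F \<longleftrightarrow> (AE x in M. E `` {x} \<subseteq> F `` {x})"

definition full_group :: "'a measure \<Rightarrow> 'a rel \<Rightarrow> ('a \<Rightarrow> 'a) set" where
  "full_group M F = {T \<in> aut M. AE x in M. (T x, x) \<in> F}"

definition phi :: "'a measure \<Rightarrow> 'a rel \<Rightarrow> ('a \<Rightarrow> 'a) \<Rightarrow> real" where
  "phi M E S = measure M {x \<in> space M. (S x, x) \<in> E}"

definition fundamental_domain ::
  "('g, 'm) monoid_scheme \<Rightarrow> 'a measure \<Rightarrow> ('g \<Rightarrow> 'a \<Rightarrow> 'a) \<Rightarrow> 'a set \<Rightarrow> bool" where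
  "fundamental_domain G M a D \<longleftrightarrow> D \<in> sets M \<and> (AE x in M. \<exists>!y. y \<in> D \<inter> orbit G a x)"

text \<open>HOL cannot quantify over the type of the points of the coupling space \<open>W\<close>. Taking the points
  to be real numbers is no restriction: every standard Borel space is Borel isomorphic to a Borel
  subset of the real line (the underlying set \<open>space W\<close> may be any set of reals, with any
  standard Borel structure).\<close>

definition measure_equivalent ::
  "('g, 'm) monoid_scheme \<Rightarrow> ('h, 'n) monoid_scheme \<Rightarrow> bool" where
  "measure_equivalent G H \<longleftrightarrow>
     (\<exists>(W :: real measure) a b.
        standard_borel W \<and> sigma_finite_measure W \<and> emeasure W (space W) \<noteq> 0 \<and>
        mp_action G W a \<and> free_action G W a \<and>
        mp_action H W b \<and> free_action H W b \<and>
        (\<forall>g \<in> carrier G. \<forall>h \<in> carrier H. \<forall>x \<in> space W. a g (b h x) = b h (a g x)) \<and>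
        (\<exists>D. fundamental_domain G W a D \<and> emeasure W D < \<infinity>) \<and>
        (\<exists>D. fundamental_domain H W b D \<and> emeasure W D < \<infinity>))"

end

theory Submission
  imports Defs
begin

text \<open>
  Write \<open>\<Gamma>\<close> and \<open>\<Delta>\<close> for the groups \<open>G\<close> and \<open>H\<close>. The coupling lives on the set of pairs \<open>(y, x)\<close> of
  \<open>F\<close>-equivalent points, where \<open>\<Gamma>\<close> moves \<open>y\<close> and \<open>\<Delta>\<close> moves \<open>x\<close>. As \<open>\<Gamma>\<close> acts freely, a pair is
  determined by \<open>x\<close> and the element \<open>g\<close> with \<open>y = g x\<close>, so this set becomes \<open>\<Omega> = \<Gamma> \<times> X\<close> with
  counting measure times \<open>\<mu>\<close>. In these coordinates \<open>\<Gamma>\<close> acts by left translation, with the fundamental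
  domain \<open>{1} \<times> X\<close> of measure one, and \<open>\<Delta>\<close> acts by \<open>(g, x) \<mapsto> (g \<alpha>(\<delta>, x)\<^sup>-\<^sup>1, \<delta> x)\<close>, where \<open>\<alpha>\<close> is the
  cocycle with \<open>\<alpha>(\<delta>, x) x = \<delta> x\<close>. A fundamental domain for \<open>\<Delta>\<close> exists as well (choose the smallest
  \<open>g\<close> on each orbit in an enumeration of \<open>\<Gamma>\<close>), but its measure is the average number of \<open>E\<close>-classes in
  an \<open>F\<close>-class, which may be infinite.

  The remedy is to replace the measure by its restriction to a set \<open>V\<close> of positive measure that is
  invariant under both groups and has finite \<open>\<Delta>\<close>-covolume, that is, meets the fundamental domain of
  \<open>\<Delta>\<close> in finite measure (\<open>invariant_set_of_finite_covolume\<close>). To find \<open>V\<close>, let \<open>\<Gamma>\<close> act isometrically on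
  the \<open>\<Delta>\<close>-invariant functions on \<open>\<Omega>\<close> that are square integrable over the fundamental domain. The
  sets \<open>A = {(y, x). S y E x}\<close> and \<open>B = {(y, x). y \<in> S'([x]\<^sub>E)}\<close> are \<open>\<Delta>\<close>-invariant of covolume at most
  one, and the covolume of \<open>\<gamma>\<^sup>-\<^sup>1 A \<inter> B\<close> is \<open>\<phi>\<^sub>E(S \<gamma> S')\<close>: on \<open>B\<close> the \<open>\<Delta>\<close>-orbits can be represented by
  the pairs \<open>(S' x, x)\<close>. By hypothesis all translates of the indicator of \<open>A\<close> have inner product at
  least \<open>c > 0\<close> with the indicator of \<open>B\<close>. The functions with values in \<open>[0, 1]\<close> all of whose
  translates have this property form a convex \<open>\<Gamma>\<close>-invariant set; by the parallelogram law a sequence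
  in it that minimises the norm converges almost everywhere, and its limit \<open>f\<close> is \<open>\<Gamma>\<close>-invariant and
  nonzero (\<open>L2_minimising_sequence\<close>). A suitable superlevel set of \<open>f\<close> is then a valid \<open>V\<close>, its covolume
  being finite by Markov's inequality.

  The covolume of a \<open>\<Delta>\<close>-invariant set does not depend on the fundamental domain
  (\<open>nn_integral_fundamental_domains_eq\<close>); this gives both the isometry of the \<open>\<Gamma>\<close>-action and the two
  computations of covolumes above.
\<close>

section \<open>Standard Borel spaces\<close>

text \<open>
  Open balls of radius \<open>1 / (k + 1)\<close> around a countable dense set separate points. The two consequences
  drawn from this are that the diagonal is measurable and that the space has at most the cardinality
  of the continuum.
\<close>

lemma standard_borel_separating:
  fixes M :: "'a measure"
  assumes "standard_borel M"
  shows "\<exists>U :: nat \<Rightarrow> 'a set. (\<forall>n. U n \<in> sets M) \<and>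
    (\<forall>x \<in> space M. \<forall>y \<in> space M. x \<noteq> y \<longrightarrow> (\<exists>n. x \<in> U n \<and> y \<notin> U n))"
proof -
  obtain T where T: "topspace T = space M" "completely_metrizable_space T" "separable_space T"
      and sets: "sets M = sigma_sets (space M) {U. openin T U}"
    using assms by (auto simp: standard_borel_def)
  obtain m d where md: "Metric_space m d" "T = Metric_space.mtopology m d"
    using T(2) by (auto simp: completely_metrizable_space_def)
  interpret Metric_space m d by fact
  have m: "m = space M" using T(1) md(2) by simp
  obtain C where C: "countable C" "C \<subseteq> m" "T closure_of C = m"
    using T(3) m T(1) by (auto simp: separable_space_def)
  have dense: "\<exists>c\<in>C. d x c < e" if "x \<in> m" "e > 0" for x e
    using C(3) that unfolding md(2) metric_closure_of by (auto simp: in_mball)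
  define V where "V = (\<lambda>(c, k::nat). mball c (1 / Suc k)) ` (C \<times> UNIV)"
  have cV: "countable V" unfolding V_def using C(1) by auto
  have VM: "V \<subseteq> sets M"
    unfolding V_def sets md(2) by (auto intro!: sigma_sets.Basic)
  have sep: "\<exists>v\<in>V. x \<in> v \<and> y \<notin> v" if xy: "x \<in> m" "y \<in> m" "x \<noteq> y" for x y
  proof -
    have "d x y > 0" using xy by simp
    then obtain k :: nat where k: "1 / Suc k < d x y / 2"
      using nat_approx_posE[of "d x y / 2"] by auto
    obtain c where c: "c \<in> C" "d x c < 1 / Suc k" using dense[OF xy(1), of "1 / Suc k"] by (metis of_nat_0_less_iff zero_less_Suc zero_less_divide_1_iff)
    have cm: "c \<in> m" using c C by auto
    have "d x y \<le> d x c + d c y" using triangle xy cm by blast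
    with c k have "d c y > 1 / Suc k" by linarith
    then have "x \<in> mball c (1 / Suc k)" "y \<notin> mball c (1 / Suc k)"
      using c(2) xy cm by (auto simp: commute)
    then show ?thesis unfolding V_def using c(1) by blast
  qed
  show ?thesis
  proof (cases "V = {}")
    case True
    then show ?thesis using sep m by (intro exI[of _ "\<lambda>_. {}"]) auto
  next
    case False
    have "\<exists>n. x \<in> from_nat_into V n \<and> y \<notin> from_nat_into V n"
      if "x \<in> m" "y \<in> m" "x \<noteq> y" for x y
      using sep[OF that] from_nat_into_surj[OF cV] by metis
    then show ?thesis
      using from_nat_into[OF False] VM m by (intro exI[of _ "from_nat_into V"]) (simp add: subset_iff)
  qed
qed

lemma standard_borel_equaliser_measurable:
  assumes "standard_borel M" and [measurable]: "f \<in> measurable N M" "g \<in> measurable N M"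
  shows "{x \<in> space N. f x = g x} \<in> sets N"
proof -
  obtain U :: "nat \<Rightarrow> _" where "\<forall>n. U n \<in> sets M"
    and sep: "\<forall>x\<in>space M. \<forall>y\<in>space M. x \<noteq> y \<longrightarrow> (\<exists>n. x \<in> U n \<and> y \<notin> U n)"
    using standard_borel_separating[OF assms(1)] by auto
  then have U[measurable]: "U n \<in> sets M" for n by simp
  have "{x \<in> space N. f x = g x} = {x \<in> space N. \<forall>n. f x \<in> U n \<longleftrightarrow> g x \<in> U n}"
  proof (intro Collect_cong conj_cong refl)
    fix x assume "x \<in> space N"
    then have "f x \<in> space M" "g x \<in> space M"
      using measurable_space[OF assms(2)] measurable_space[OF assms(3)] by auto
    then show "f x = g x \<longleftrightarrow> (\<forall>n. f x \<in> U n \<longleftrightarrow> g x \<in> U n)"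
      using sep by metis
  qed
  also have "\<dots> \<in> sets N" by measurable
  finally show ?thesis .
qed

lemma standard_borel_inj_real:
  fixes M :: "'a measure"
  assumes "standard_borel M"
  obtains f :: "'a \<Rightarrow> real" where "inj_on f (space M)"
proof -
  obtain U :: "nat \<Rightarrow> 'a set" where
    sep: "\<forall>x\<in>space M. \<forall>y\<in>space M. x \<noteq> y \<longrightarrow> (\<exists>n. x \<in> U n \<and> y \<notin> U n)"
    using standard_borel_separating[OF assms] by auto
  obtain F :: "nat set \<Rightarrow> real" where F: "inj F"
    using nat_sets_eqpoll_reals unfolding eqpoll_def bij_betw_def by blast
  have "inj_on (\<lambda>x. F {n. x \<in> U n}) (space M)"
  proof (rule inj_onI)
    fix x y assume xy: "x \<in> space M" "y \<in> space M" "F {n. x \<in> U n} = F {n. y \<in> U n}"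
    then have "{n. x \<in> U n} = {n. y \<in> U n}" using F by (simp add: inj_eq)
    then show "x = y" using sep xy(1,2) by blast
  qed
  then show thesis by (rule that)
qed

text \<open>
  The topology is carried along with the \<open>\<sigma>\<close>-algebra, and complete metrizability and separability
  are preserved because the injection becomes a homeomorphism onto its image.
\<close>

lemma standard_borel_embed_measure:
  assumes "standard_borel M" and inj: "inj_on f (space M)"
  shows "standard_borel (embed_measure M f)"
proof -
  obtain T where T: "topspace T = space M" "completely_metrizable_space T" "separable_space T"
      and sets: "sets M = sigma_sets (space M) {U. openin T U}"
    using assms by (auto simp: standard_borel_def)
  define T' where "T' = pullback_topology (f ` space M) (the_inv_into (space M) f) T"
  have op: "openin T' V \<longleftrightarrow> (\<exists>U. openin T U \<and> V = f ` U)" for V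
    unfolding T'_def openin_pullback_topology
    using the_inv_into_vimage[OF inj] openin_subset[of T] T(1) by metis
  have top: "topspace T' = f ` space M"
    unfolding T'_def topspace_pullback_topology T(1) by (simp add: the_inv_into_vimage[OF inj])
  have hom: "homeomorphic_map T T' f"
  proof (rule bijective_open_imp_homeomorphic_map)
    show "open_map T T' f" unfolding open_map_def op by blast
    show "continuous_map T T' f"
      unfolding continuous_map_def
    proof (intro conjI allI impI)
      fix V assume "openin T' V"
      then obtain U where U: "openin T U" "V = f ` U" unfolding op by blast
      moreover have "{x \<in> topspace T. f x \<in> V} = U"
        using U openin_subset[OF U(1)] inj T(1) by (auto dest: inj_onD)
      ultimately show "openin T {x \<in> topspace T. f x \<in> V}" by simp
    qed (auto simp: top T(1))
  qed (use T(1) top inj in auto)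
  then have h: "T homeomorphic_space T'" by (rule homeomorphic_map_imp_homeomorphic_space)
  have "sets (embed_measure M f) = sigma_sets (f ` space M) {V. openin T' V}"
  proof -
    have g: "the_inv_into (space M) f \<in> f ` space M \<rightarrow> space M"
      using inj by (rule the_inv_into_in_Pi)
    have "sets (embed_measure M f)
        = sets (vimage_algebra (f ` space M) (the_inv_into (space M) f) (sigma (space M) {U. openin T U}))"
      unfolding sets_embed_eq_vimage_algebra[OF inj]
      using T(1) by (intro sets_vimage_algebra_cong, subst sets_measure_of) (auto simp: sets dest!: openin_subset)
    also have "\<dots> = sigma_sets (f ` space M)
        {the_inv_into (space M) f -` A \<inter> f ` space M |A. A \<in> {U. openin T U}}"
      using g T(1) by (subst vimage_algebra_sigma) (auto simp: sets_measure_of_conv dest!: openin_subset)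
    also have "{the_inv_into (space M) f -` A \<inter> f ` space M |A. A \<in> {U. openin T U}}
        = (`) f ` {U. openin T U}"
      unfolding image_def[of "(`) f"]
    proof (intro Collect_cong iffI)
      fix V assume "\<exists>A. V = the_inv_into (space M) f -` A \<inter> f ` space M \<and> A \<in> {U. openin T U}"
      then obtain A where "V = the_inv_into (space M) f -` A \<inter> f ` space M" "openin T A" by blast
      then show "\<exists>A\<in>{U. openin T U}. V = f ` A"
        using the_inv_into_vimage[OF inj] T(1) openin_subset[of T A] by auto
    next
      fix V assume "\<exists>A\<in>{U. openin T U}. V = f ` A"
      then obtain A where "V = f ` A" "openin T A" by blast
      then show "\<exists>A. V = the_inv_into (space M) f -` A \<inter> f ` space M \<and> A \<in> {U. openin T U}"
        using the_inv_into_vimage[OF inj, of A] T(1) openin_subset[of T A]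
        by (intro exI[of _ A]) auto
    qed
    also have "(`) f ` {U. openin T U} = {V. openin T' V}" using op by auto
    finally show ?thesis .
  qed
  then show ?thesis
    unfolding standard_borel_def
    using h T homeomorphic_completely_metrizable_space homeomorphic_separable_space top
    by (metis space_embed_measure)
qed

lemma standard_borel_count_space_pair:
  assumes "standard_borel M" and G: "countable G"
  shows "standard_borel (count_space G \<Otimes>\<^sub>M M)"
proof -
  obtain T where T: "topspace T = space M" "completely_metrizable_space T" "separable_space T"
      and sets: "sets M = sigma_sets (space M) {U. openin T U}"
    using assms by (auto simp: standard_borel_def)
  let ?T = "prod_topology (discrete_topology G) T"
  have "completely_metrizable_space ?T"
    using T by (simp add: completely_metrizable_space_prod_topology completely_metrizable_space_discrete_topology)
  moreover have "separable_space ?T"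
  proof -
    obtain C where C: "countable C" "C \<subseteq> topspace T" "T closure_of C = topspace T"
      using T(3) by (auto simp: separable_space_def)
    show ?thesis
      unfolding separable_space_def
      using C G by (intro exI[of _ "G \<times> C"]) (auto simp: closure_of_Times discrete_topology_closure_of)
  qed
  moreover have "sets (count_space G \<Otimes>\<^sub>M M) = sigma_sets (G \<times> space M) {W. openin ?T W}"
  proof
    have Ea: "sigma_sets G ((\<lambda>g. {g}) ` G) = Pow G"
    proof
      show "Pow G \<subseteq> sigma_sets G ((\<lambda>g. {g}) ` G)"
      proof
        fix B assume "B \<in> Pow G"
        then have "countable B" "B \<subseteq> G" using G countable_subset by auto
        then have "(\<Union>g\<in>B. {g}) \<in> sigma_sets G ((\<lambda>g. {g}) ` G)"
          by (intro sigma_sets_UNION) (auto intro!: sigma_sets.Basic)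
        then show "B \<in> sigma_sets G ((\<lambda>g. {g}) ` G)" by simp
      qed
    qed (use sigma_sets_into_sp[of "(\<lambda>g. {g}) ` G" G] in auto)
    have "sets (count_space G \<Otimes>\<^sub>M M)
        = sets (sigma (G \<times> space M) {A \<times> B |A B. A \<in> (\<lambda>g. {g}) ` G \<and> B \<in> {U. openin T U}})"
      by (subst sets_pair_eq[where Ea = "(\<lambda>g. {g}) ` G" and Ca = "(\<lambda>g. {g}) ` G"
            and Eb = "{U. openin T U}" and Cb = "{topspace T}"])
         (use G T(1) Ea openin_topspace[of T] in \<open>auto simp: sets dest!: openin_subset\<close>)
    also have "\<dots> = sigma_sets (G \<times> space M)
        {A \<times> B |A B. A \<in> (\<lambda>g. {g}) ` G \<and> B \<in> {U. openin T U}}"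
      using T(1) by (subst sets_measure_of) (auto dest: openin_subset)
    also have "\<dots> \<subseteq> sigma_sets (G \<times> space M) {W. openin ?T W}"
      by (intro sigma_sets_mono') (auto simp: openin_prod_Times_iff)
    finally show "sets (count_space G \<Otimes>\<^sub>M M) \<subseteq> sigma_sets (G \<times> space M) {W. openin ?T W}" .
    have "W \<in> sets (count_space G \<Otimes>\<^sub>M M)" if W: "openin ?T W" for W
    proof -
      have "openin T {x \<in> topspace T. (g, x) \<in> W}" if "g \<in> G" for g
        using continuous_map_pairwise that W
        by (intro openin_continuous_map_preimage[of _ ?T]) (auto simp: o_def continuous_map_pairedI)
      then have "{x \<in> topspace T. (g, x) \<in> W} \<in> sets M" if "g \<in> G" for g
        unfolding sets using that by (auto intro: sigma_sets.Basic)
      then have "(\<Union>g\<in>G. {g} \<times> {x \<in> topspace T. (g, x) \<in> W}) \<in> sets (count_space G \<Otimes>\<^sub>M M)"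
        using G by (intro sets.countable_UN'') auto
      also have "(\<Union>g\<in>G. {g} \<times> {x \<in> topspace T. (g, x) \<in> W}) = W"
        using openin_subset[OF W] by auto
      finally show ?thesis .
    qed
    then show "sigma_sets (G \<times> space M) {W. openin ?T W} \<subseteq> sets (count_space G \<Otimes>\<^sub>M M)"
      using sets.sigma_sets_subset[of "{W. openin ?T W}" "count_space G \<Otimes>\<^sub>M M"]
      by (auto simp: space_pair_measure)
  qed
  ultimately show ?thesis
    unfolding standard_borel_def
    by (intro exI[of _ ?T]) (simp add: space_pair_measure T(1))
qed

section \<open>Measure preserving actions\<close>

lemma mp_action_group_action: "mp_action G M a \<Longrightarrow> group_action G (space M) a"
  by (simp add: mp_action_def)

lemma mp_action_group: "mp_action G M a \<Longrightarrow> group G"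
  by (auto simp: mp_action_def group_action_def group_hom_def)

lemma mp_action_measurable:
  "mp_action G M a \<Longrightarrow> g \<in> carrier G \<Longrightarrow> a g \<in> measurable M M"
  by (simp add: mp_action_def aut_def)

lemma mp_action_closed:
  "mp_action G M a \<Longrightarrow> g \<in> carrier G \<Longrightarrow> x \<in> space M \<Longrightarrow> a g x \<in> space M"
  using measurable_space[OF mp_action_measurable] by metis

lemma mp_action_mult:
  "mp_action G M a \<Longrightarrow> g \<in> carrier G \<Longrightarrow> h \<in> carrier G \<Longrightarrow> x \<in> space M \<Longrightarrow>
   a (g \<otimes>\<^bsub>G\<^esub> h) x = a g (a h x)"
  using group_action.composition_rule[OF mp_action_group_action] by metis

lemma mp_action_one: "mp_action G M a \<Longrightarrow> x \<in> space M \<Longrightarrow> a \<one>\<^bsub>G\<^esub> x = x"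
  by (metis mp_action_group_action group_action.id_eq_one restrict_apply')

lemma mp_action_inv_cancel:
  assumes "mp_action G M a" "g \<in> carrier G" "x \<in> space M"
  shows "a (inv\<^bsub>G\<^esub> g) (a g x) = x" "a g (a (inv\<^bsub>G\<^esub> g) x) = x"
proof -
  interpret group G using assms(1) by (rule mp_action_group)
  show "a (inv\<^bsub>G\<^esub> g) (a g x) = x"
    using mp_action_mult[OF assms(1), of "inv\<^bsub>G\<^esub> g" g x] mp_action_one[OF assms(1)] assms by simp
  show "a g (a (inv\<^bsub>G\<^esub> g) x) = x"
    using mp_action_mult[OF assms(1), of g "inv\<^bsub>G\<^esub> g" x] mp_action_one[OF assms(1)] assms by simp
qed

lemma mp_action_distr:
  assumes "mp_action G M a" "g \<in> carrier G"
  shows "distr M M (a g) = M"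
proof (rule measure_eqI)
  fix A assume "A \<in> sets (distr M M (a g))"
  then show "emeasure (distr M M (a g)) A = emeasure M A"
    using assms by (simp add: emeasure_distr[OF mp_action_measurable[OF assms]] mp_action_def aut_def)
qed simp

lemma mp_action_nn_integral:
  assumes "mp_action G M a" "g \<in> carrier G" "u \<in> borel_measurable M"
  shows "(\<integral>\<^sup>+x. u (a g x) \<partial>M) = (\<integral>\<^sup>+x. u x \<partial>M)"
  using nn_integral_distr[OF mp_action_measurable[OF assms(1,2)], of u]
    mp_action_distr[OF assms(1,2)] assms(3) by simp

lemma mp_action_AE:
  assumes "mp_action G M a" "g \<in> carrier G" "AE x in M. P x"
  shows "AE x in M. P (a g x)"
proof -
  have "AE x in distr M M (a g). P x"
    unfolding mp_action_distr[OF assms(1,2)] by (rule assms(3))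
  then show ?thesis by (rule AE_distrD[OF mp_action_measurable[OF assms(1,2)]])
qed

lemma emeasure_vimage_eq_nn_integral:
  assumes "f \<in> measurable M N" "A \<in> sets N"
  shows "emeasure M (f -` A \<inter> space M) = (\<integral>\<^sup>+x. indicator A (f x) \<partial>M)"
proof -
  have "(\<integral>\<^sup>+x. indicator A (f x) \<partial>M) = (\<integral>\<^sup>+x. indicator (f -` A \<inter> space M) x \<partial>M)"
    by (intro nn_integral_cong) (simp add: indicator_def)
  then show ?thesis using measurable_sets[OF assms] by simp
qed

text \<open>
  Invertibility, including measurability of the inverse maps, comes for free from the action laws.
  The requirement of extensionality reflects that actions are homomorphisms into a group of
  bijections that are undefined outside the space.
\<close>

lemma mp_actionI:
  assumes "group G"
    and meas: "\<And>g. g \<in> carrier G \<Longrightarrow> a g \<in> measurable M M"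
    and ext: "\<And>g. g \<in> carrier G \<Longrightarrow> a g \<in> extensional (space M)"
    and one: "\<And>x. x \<in> space M \<Longrightarrow> a \<one>\<^bsub>G\<^esub> x = x"
    and mult: "\<And>g h x. \<lbrakk>g \<in> carrier G; h \<in> carrier G; x \<in> space M\<rbrakk> \<Longrightarrow>
       a (g \<otimes>\<^bsub>G\<^esub> h) x = a g (a h x)"
    and pres: "\<And>g A. \<lbrakk>g \<in> carrier G; A \<in> sets M\<rbrakk> \<Longrightarrow> emeasure M (a g -` A \<inter> space M) = emeasure M A"
  shows "mp_action G M a"
proof -
  interpret group G by fact
  have cl: "a g x \<in> space M" if "g \<in> carrier G" "x \<in> space M" for g x
    using meas[OF that(1)] that(2) by (rule measurable_space)
  have inv: "a (inv\<^bsub>G\<^esub> g) (a g x) = x" "a g (a (inv\<^bsub>G\<^esub> g) x) = x" if "g \<in> carrier G" "x \<in> space M" for g x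
    using mult[of "inv\<^bsub>G\<^esub> g" g x] mult[of g "inv\<^bsub>G\<^esub> g" x] one that by auto
  have bij: "bij_betw (a g) (space M) (space M)" if "g \<in> carrier G" for g
    using that inv cl by (intro bij_betwI[where g = "a (inv\<^bsub>G\<^esub> g)"]) auto
  have Bij: "a g \<in> Bij (space M)" if "g \<in> carrier G" for g
    using bij ext that by (simp add: Bij_def)
  have "a \<in> hom G (BijGroup (space M))"
  proof (rule homI)
    fix g h assume gh: "g \<in> carrier G" "h \<in> carrier G"
    have "a (g \<otimes>\<^bsub>G\<^esub> h) = compose (space M) (a g) (a h)"
      using gh ext[of "g \<otimes>\<^bsub>G\<^esub> h"] mult[OF gh] by (intro extensionalityI[of _ "space M"]) (auto simp: compose_def)
    then show "a (g \<otimes>\<^bsub>G\<^esub> h) = a g \<otimes>\<^bsub>BijGroup (space M)\<^esub> a h"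
      using gh Bij by (simp add: BijGroup_def)
  qed (use Bij in \<open>simp add: BijGroup_def\<close>)
  then have "group_action G (space M) a"
    by (simp add: group_action_def group_hom_def group_hom_axioms_def group_axioms group_BijGroup)
  moreover have "a g \<in> aut M" if g: "g \<in> carrier G" for g
  proof -
    have eq: "inv_into (space M) (a g) x = a (inv\<^bsub>G\<^esub> g) x" if "x \<in> space M" for x
      using bij[OF g] inv[OF g that] cl[of "inv\<^bsub>G\<^esub> g" x] g that
      by (intro inv_into_f_eq) (auto simp: bij_betw_def)
    have "inv_into (space M) (a g) \<in> measurable M M"
      using meas[of "inv\<^bsub>G\<^esub> g"] g by (subst measurable_cong[OF eq]) auto
    then show ?thesis using bij meas pres g by (simp add: aut_def)
  qed
  ultimately show ?thesis by (simp add: mp_action_def)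
qed

lemma mp_action_orbit_subset:
  "mp_action G W a \<Longrightarrow> w \<in> space W \<Longrightarrow> orbit G a w \<subseteq> space W"
  by (auto simp: orbit_def dest: mp_action_closed)

lemma trivial_stabilizer_eqD:
  assumes "mp_action K M k" "stabilizer K k x = {\<one>\<^bsub>K\<^esub>}" "x \<in> space M"
    and gh: "g \<in> carrier K" "h \<in> carrier K" "k g x = k h x"
  shows "g = h"
proof -
  interpret K: group K using assms(1) by (rule mp_action_group)
  have "k (inv\<^bsub>K\<^esub> h \<otimes>\<^bsub>K\<^esub> g) x = x"
    using gh assms(3) mp_action_mult[OF assms(1), of "inv\<^bsub>K\<^esub> h" g x]
      mp_action_inv_cancel(1)[OF assms(1), of h x] by simp
  then have "inv\<^bsub>K\<^esub> h \<otimes>\<^bsub>K\<^esub> g \<in> stabilizer K k x"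
    using gh by (simp add: stabilizer_def)
  then have "inv\<^bsub>K\<^esub> h \<otimes>\<^bsub>K\<^esub> g = \<one>\<^bsub>K\<^esub>"
    using assms(2) by simp
  then have "inv\<^bsub>K\<^esub> g = inv\<^bsub>K\<^esub> h"
    using gh by (intro K.inv_equality) auto
  then show ?thesis using gh by (metis K.inv_inv)
qed

text \<open>
  Restricting the measure rather than the space keeps the action laws and the standard Borel structure
  as they are.
\<close>

lemma mp_action_density_indicator:
  assumes act: "mp_action G W a" and V[measurable]: "V \<in> sets W"
    and inv: "\<And>g. g \<in> carrier G \<Longrightarrow> AE w in W. a g w \<in> V \<longleftrightarrow> w \<in> V"
  shows "mp_action G (density W (indicator V)) a"
proof -
  have "emeasure (density W (indicator V)) (a g -` A \<inter> space W) = emeasure (density W (indicator V)) A"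
    if g: "g \<in> carrier G" and A[measurable]: "A \<in> sets W" for g A
  proof -
    note [measurable] = mp_action_measurable[OF act g]
    have "emeasure (density W (indicator V)) (a g -` A \<inter> space W)
        = (\<integral>\<^sup>+w. indicator V w * indicator (a g -` A \<inter> space W) w \<partial>W)"
      by (intro emeasure_density) auto
    also have "\<dots> = (\<integral>\<^sup>+w. indicator V (a g w) * indicator A (a g w) \<partial>W)"
      using inv[OF g] AE_space
      by (intro nn_integral_cong_AE, eventually_elim) (simp add: indicator_def)
    also have "\<dots> = (\<integral>\<^sup>+w. indicator V w * indicator A w \<partial>W)"
      using mp_action_nn_integral[OF act g, of "\<lambda>w. indicator V w * indicator A w"] by simp
    also have "\<dots> = emeasure (density W (indicator V)) A"
      by (intro emeasure_density[symmetric]) auto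
    finally show ?thesis .
  qed
  then show ?thesis
    using act by (simp add: mp_action_def aut_def)
qed

section \<open>Integration over fundamental domains\<close>

lemma nn_integral_count_space_ex1:
  assumes "\<exists>!i. i \<in> I \<and> f i \<in> D"
  shows "(\<integral>\<^sup>+i. indicator D (f i) \<partial>count_space I) = 1"
proof -
  obtain j where j: "j \<in> I" and ji: "\<forall>i\<in>I. f i \<in> D \<longleftrightarrow> i = j"
    using assms by (metis (no_types))
  have "(\<integral>\<^sup>+i. indicator D (f i) \<partial>count_space I) = (\<integral>\<^sup>+i. indicator {j} i \<partial>count_space I)"
    using ji by (intro nn_integral_cong) (simp add: indicator_def)
  also have "\<dots> = 1" using j by simp
  finally show ?thesis .
qed

lemma nn_integral_count_space_le_1:
  assumes "\<And>i j. \<lbrakk>i \<in> I; j \<in> I; P i; P j\<rbrakk> \<Longrightarrow> i = j"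
  shows "(\<integral>\<^sup>+i. of_bool (P i) \<partial>count_space I) \<le> 1"
proof -
  have "(\<integral>\<^sup>+i. of_bool (P i) \<partial>count_space I) = of_bool (\<exists>i\<in>I. P i)"
    using assms by (intro of_bool_Bex_eq_nn_integral[symmetric]) auto
  then show ?thesis by simp
qed

lemma mp_action_ex1_inv:
  assumes "mp_action H W b" and ex1: "\<exists>!d. d \<in> carrier H \<and> b d w \<in> D"
  shows "\<exists>!d. d \<in> carrier H \<and> b (inv\<^bsub>H\<^esub> d) w \<in> D"
proof -
  interpret group H using assms(1) by (rule mp_action_group)
  from ex1 show ?thesis
    by (metis inv_closed inv_inv)
qed

text \<open>
  Counting group elements instead of orbit points is the form used for all computations: it makes
  freeness and the transversal property a single condition.
\<close>

lemma fundamental_domainI: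
  assumes "D \<in> sets W" and "AE w in W. \<exists>!g. g \<in> carrier G \<and> a g w \<in> D"
  shows "fundamental_domain G W a D"
  unfolding fundamental_domain_def
proof (intro conjI assms(1))
  show "AE w in W. \<exists>!y. y \<in> D \<inter> orbit G a w"
    using assms(2) by eventually_elim (auto simp: orbit_def)
qed

text \<open>
  Both integrals equal the sum over \<open>d\<close> of the integrals of \<open>u\<close> over \<open>D \<inter> d\<^sup>-\<^sup>1 D'\<close>, because the translates
  of \<open>D'\<close> partition the support of \<open>u\<close>, and so do those of \<open>D\<close>. Both sets have to be transversals only
  where \<open>u\<close> does not vanish, which allows one of them to be adapted to \<open>u\<close>.
\<close>

lemma nn_integral_fundamental_domains_eq:
  assumes act: "mp_action H W b" and cH: "countable (carrier H)"
    and [measurable]: "u \<in> borel_measurable W" "D \<in> sets W" "D' \<in> sets W"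
    and u_inv: "\<And>d. d \<in> carrier H \<Longrightarrow> AE w in W. u (b d w) = u w"
    and D: "AE w in W. u w \<noteq> 0 \<longrightarrow> (\<exists>!d. d \<in> carrier H \<and> b d w \<in> D)"
    and D': "AE w in W. u w \<noteq> 0 \<longrightarrow> (\<exists>!d. d \<in> carrier H \<and> b d w \<in> D')"
  shows "(\<integral>\<^sup>+w. u w * indicator D w \<partial>W) = (\<integral>\<^sup>+w. u w * indicator D' w \<partial>W)"
proof -
  interpret group H using act by (rule mp_action_group)
  have [measurable]: "b d \<in> measurable W W" if "d \<in> carrier H" for d
    using act that by (rule mp_action_measurable)
  have "(\<integral>\<^sup>+w. u w * indicator D w \<partial>W)
      = (\<integral>\<^sup>+w. \<integral>\<^sup>+d. u w * indicator D w * indicator D' (b d w) \<partial>count_space (carrier H) \<partial>W)"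
  proof (rule nn_integral_cong_AE, use D' in eventually_elim)
    fix w assume w: "u w \<noteq> 0 \<longrightarrow> (\<exists>!d. d \<in> carrier H \<and> b d w \<in> D')"
    show "u w * indicator D w
        = (\<integral>\<^sup>+d. u w * indicator D w * indicator D' (b d w) \<partial>count_space (carrier H))"
      using w by (cases "u w = 0") (simp_all add: nn_integral_cmult nn_integral_count_space_ex1)
  qed
  also have "\<dots> = (\<integral>\<^sup>+d. \<integral>\<^sup>+w. u w * indicator D w * indicator D' (b d w) \<partial>W \<partial>count_space (carrier H))"
    using cH by (intro nn_integral_count_space_nn_integral) auto
  also have "\<dots> = (\<integral>\<^sup>+d. \<integral>\<^sup>+w. u w * indicator D' w * indicator D (b (inv\<^bsub>H\<^esub> d) w) \<partial>W \<partial>count_space (carrier H))"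
  proof (rule nn_integral_cong)
    fix d assume "d \<in> space (count_space (carrier H))"
    then have d[simp]: "d \<in> carrier H" by simp
    have "(\<integral>\<^sup>+w. u w * indicator D w * indicator D' (b d w) \<partial>W)
        = (\<integral>\<^sup>+w. u (b (inv\<^bsub>H\<^esub> d) w) * indicator D (b (inv\<^bsub>H\<^esub> d) w) * indicator D' (b d (b (inv\<^bsub>H\<^esub> d) w)) \<partial>W)"
      by (subst mp_action_nn_integral[OF act inv_closed[OF d], symmetric]) auto
    also have "\<dots> = (\<integral>\<^sup>+w. u w * indicator D' w * indicator D (b (inv\<^bsub>H\<^esub> d) w) \<partial>W)"
    proof (rule nn_integral_cong_AE, use u_inv[OF inv_closed[OF d]] AE_space in eventually_elim)
      fix w assume "u (b (inv\<^bsub>H\<^esub> d) w) = u w" "w \<in> space W"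
      then show "u (b (inv\<^bsub>H\<^esub> d) w) * indicator D (b (inv\<^bsub>H\<^esub> d) w) * indicator D' (b d (b (inv\<^bsub>H\<^esub> d) w))
          = u w * indicator D' w * indicator D (b (inv\<^bsub>H\<^esub> d) w)"
        using mp_action_inv_cancel[OF act d] by (simp add: mult_ac)
    qed
    finally show "(\<integral>\<^sup>+w. u w * indicator D w * indicator D' (b d w) \<partial>W)
        = (\<integral>\<^sup>+w. u w * indicator D' w * indicator D (b (inv\<^bsub>H\<^esub> d) w) \<partial>W)" .
  qed
  also have "\<dots> = (\<integral>\<^sup>+w. \<integral>\<^sup>+d. u w * indicator D' w * indicator D (b (inv\<^bsub>H\<^esub> d) w) \<partial>count_space (carrier H) \<partial>W)"
    using cH by (intro nn_integral_count_space_nn_integral[symmetric]) auto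
  also have "\<dots> = (\<integral>\<^sup>+w. u w * indicator D' w \<partial>W)"
  proof (rule nn_integral_cong_AE, use D in eventually_elim)
    fix w assume w: "u w \<noteq> 0 \<longrightarrow> (\<exists>!d. d \<in> carrier H \<and> b d w \<in> D)"
    show "(\<integral>\<^sup>+d. u w * indicator D' w * indicator D (b (inv\<^bsub>H\<^esub> d) w) \<partial>count_space (carrier H))
        = u w * indicator D' w"
      using w mp_action_ex1_inv[OF act, of w D]
      by (cases "u w = 0") (simp_all add: nn_integral_cmult nn_integral_count_space_ex1)
  qed
  finally show ?thesis .
qed

text \<open>
  A failure anywhere on an orbit is a failure at a point of \<open>D\<close> on that orbit, and the countably many
  translates of a null subset of \<open>D\<close> are null.
\<close>

lemma AE_invariant_from_transversal:
  assumes act: "mp_action H W b" and cH: "countable (carrier H)"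
    and inv: "\<And>d w. \<lbrakk>d \<in> carrier H; w \<in> space W; P (b d w)\<rbrakk> \<Longrightarrow> P w"
    and D: "AE w in W. \<exists>d \<in> carrier H. b d w \<in> D"
    and P: "AE w in W. w \<in> D \<longrightarrow> P w"
  shows "AE w in W. P w"
proof -
  have "AE w in W. \<forall>d \<in> carrier H. b d w \<in> D \<longrightarrow> P (b d w)"
    using cH mp_action_AE[OF act _ P] by (simp add: AE_ball_countable)
  with D AE_space show ?thesis
    by eventually_elim (use inv in blast)
qed
text \<open>
  The translate of a fundamental domain of \<open>H\<close> by an element commuting with \<open>H\<close> is again a
  fundamental domain. Hence \<open>G\<close> acts isometrically on the functions on the quotient by \<open>H\<close>.
\<close>

lemma nn_integral_translate_mod:
  assumes actG: "mp_action G W a" and actH: "mp_action H W b" and cH: "countable (carrier H)"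
    and comm: "\<And>g h w. \<lbrakk>g \<in> carrier G; h \<in> carrier H; w \<in> space W\<rbrakk> \<Longrightarrow> a g (b h w) = b h (a g w)"
    and [measurable]: "D \<in> sets W" "u \<in> borel_measurable W"
    and D: "AE w in W. \<exists>!d. d \<in> carrier H \<and> b d w \<in> D"
    and u: "\<And>d w. \<lbrakk>d \<in> carrier H; w \<in> space W\<rbrakk> \<Longrightarrow> u (b d w) = u w"
    and g: "g \<in> carrier G"
  shows "(\<integral>\<^sup>+w. u (a g w) * indicator D w \<partial>W) = (\<integral>\<^sup>+w. u w * indicator D w \<partial>W)"
proof -
  interpret G: group G using actG by (rule mp_action_group)
  \<comment> \<open>translating by \<open>h\<close> moves the action of \<open>g\<close> from the integrand to the domain of integration\<close>
  define h where "h = inv\<^bsub>G\<^esub> g"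
  have h: "h \<in> carrier G" using g by (simp add: h_def)
  note [measurable] = mp_action_measurable[OF actG g] mp_action_measurable[OF actG h]
  define D' where "D' = {w \<in> space W. a h w \<in> D}"
  have [measurable]: "D' \<in> sets W" unfolding D'_def by measurable
  have "(\<integral>\<^sup>+w. u (a g w) * indicator D w \<partial>W) = (\<integral>\<^sup>+w. u (a g (a h w)) * indicator D (a h w) \<partial>W)"
    by (subst mp_action_nn_integral[OF actG h, symmetric]) auto
  also have "\<dots> = (\<integral>\<^sup>+w. u w * indicator D' w \<partial>W)"
    using mp_action_inv_cancel[OF actG g]
    by (intro nn_integral_cong) (auto simp: D'_def h_def indicator_def)
  also have "\<dots> = (\<integral>\<^sup>+w. u w * indicator D w \<partial>W)"
  proof (rule nn_integral_fundamental_domains_eq[OF actH cH])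
    have "AE w in W. \<exists>!d. d \<in> carrier H \<and> b d w \<in> D'"
      using mp_action_AE[OF actG h D] AE_space
    proof eventually_elim
      fix w assume *: "\<exists>!d. d \<in> carrier H \<and> b d (a h w) \<in> D" and w: "w \<in> space W"
      have "(d \<in> carrier H \<and> b d w \<in> D') = (d \<in> carrier H \<and> b d (a h w) \<in> D)" for d
        using comm[OF h _ w, of d] mp_action_closed[OF actH _ w, of d] by (auto simp: D'_def)
      with * show "\<exists>!d. d \<in> carrier H \<and> b d w \<in> D'" by simp
    qed
    then show "AE w in W. u w \<noteq> 0 \<longrightarrow> (\<exists>!d. d \<in> carrier H \<and> b d w \<in> D')"
      by eventually_elim simp
    show "AE w in W. u w \<noteq> 0 \<longrightarrow> (\<exists>!d. d \<in> carrier H \<and> b d w \<in> D)"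
      using D by eventually_elim simp
    show "AE w in W. u (b d w) = u w" if "d \<in> carrier H" for d
      using AE_space by eventually_elim (simp add: u that)
  qed auto
  finally show ?thesis .
qed

section \<open>Minimising sequences in midpoint convex sets of square integrable functions\<close>

text \<open>
  By the parallelogram law, two elements of \<open>K\<close> whose square integrals are close to the infimum are close
  to each other in \<open>L\<^sup>2\<close>. A minimising sequence is therefore Cauchy, and if the infimum is approached at a
  geometric rate it converges almost everywhere. For the same reason every norm preserving map \<open>T\<close> of \<open>K\<close>
  into itself moves the members of the sequence less and less, which makes the limit a fixed point of
  \<open>T\<close>.
\<close>

lemma L2_minimising_sequence:
  fixes N :: "'b measure" and K :: "('b \<Rightarrow> real) set"
  assumes ne: "K \<noteq> {}"
    and meas: "\<And>u. u \<in> K \<Longrightarrow> u \<in> borel_measurable N"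
    and int: "\<And>u. u \<in> K \<Longrightarrow> integrable N (\<lambda>x. (u x)\<^sup>2)"
    and mid: "\<And>u v. \<lbrakk>u \<in> K; v \<in> K\<rbrakk> \<Longrightarrow> (\<lambda>x. (u x + v x) / 2) \<in> K"
  shows "\<exists>s. (\<forall>n::nat. s n \<in> K) \<and> (AE x in N. convergent (\<lambda>n. s n x)) \<and>
    (\<integral>\<^sup>+x. ennreal ((lim (\<lambda>n. s n x))\<^sup>2) \<partial>N) < \<infinity> \<and>
    (\<forall>T. (\<forall>u\<in>K. T u \<in> K \<and> (\<integral>x. (T u x)\<^sup>2 \<partial>N) = (\<integral>x. (u x)\<^sup>2 \<partial>N)) \<longrightarrow>
      (\<lambda>n. \<integral>\<^sup>+x. ennreal ((T (s n) x - s n x)\<^sup>2) \<partial>N) \<longlonglongrightarrow> 0)"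
proof -
  define I where "I u = (\<integral>x. (u x)\<^sup>2 \<partial>N)" for u :: "'b \<Rightarrow> real"
  define e where "e n = (1/4::real)^n" for n
  have e: "0 \<le> e n" "e (Suc n) = e n / 4" "e n \<le> 1" for n
    by (simp_all add: e_def power_le_one)
  define d where "d = Inf (I ` K)"
  have bdd: "bdd_below (I ` K)"
    by (rule bdd_belowI[of _ 0]) (auto simp: I_def)
  have d_le: "d \<le> I u" if "u \<in> K" for u
    unfolding d_def using bdd that by (intro cINF_lower)
  have dist: "integrable N (\<lambda>x. (u x - v x)\<^sup>2)"
    "(\<integral>x. (u x - v x)\<^sup>2 \<partial>N) \<le> 2 * (I u - d) + 2 * (I v - d)" if "u \<in> K" "v \<in> K" for u v
  proof -
    let ?w = "\<lambda>x. (u x + v x) / 2"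
    have eq: "(u x - v x)\<^sup>2 = 2 * (u x)\<^sup>2 + 2 * (v x)\<^sup>2 - 4 * (?w x)\<^sup>2" for x
      by (simp add: power2_eq_square field_simps)
    note i = int[OF that(1)] int[OF that(2)] int[OF mid[OF that]]
    show "integrable N (\<lambda>x. (u x - v x)\<^sup>2)"
      unfolding eq using i by simp
    have "(\<integral>x. (u x - v x)\<^sup>2 \<partial>N) = 2 * I u + 2 * I v - 4 * I ?w"
      unfolding eq I_def using i by simp
    then show "(\<integral>x. (u x - v x)\<^sup>2 \<partial>N) \<le> 2 * (I u - d) + 2 * (I v - d)"
      using d_le[OF mid[OF that]] by simp
  qed
  \<comment> \<open>the rate \<open>e n = 4^-n\<close> beats the weights \<open>2^n\<close> used for convergence below, and the factor \<open>1/4\<close>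
    absorbs the constants of the parallelogram law\<close>
  have "\<exists>u\<in>K. I u < d + e n / 4" for n :: nat
    using cInf_lessD[of "I ` K" "d + e n / 4"] ne unfolding d_def e_def by auto
  then obtain s where sK: "\<And>n. s n \<in> K" and sI: "\<And>n. I (s n) < d + e n / 4"
    by metis
  have sI_le: "I (s n) - d \<le> e n / 4" for n
    using sI[of n] by simp
  note [measurable] = meas[OF sK]
  have nn: "(\<integral>\<^sup>+x. ennreal ((u x - v x)\<^sup>2) \<partial>N) \<le> ennreal (2 * (I u - d) + 2 * (I v - d))"
    if "u \<in> K" "v \<in> K" for u v
    using dist[OF that] by (subst nn_integral_eq_integral) (auto intro: ennreal_leI)
  have step: "(\<integral>\<^sup>+x. ennreal ((s (Suc n) x - s n x)\<^sup>2) \<partial>N) \<le> ennreal (e n)" for n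
  proof -
    have "2 * (I (s (Suc n)) - d) + 2 * (I (s n) - d) \<le> e n"
      using sI_le[of n] sI_le[of "Suc n"] e[of n] by argo
    then show ?thesis
      using nn[OF sK sK, of "Suc n" n] by (meson ennreal_leI order_trans)
  qed
  have conv: "AE x in N. convergent (\<lambda>n. s n x)"
  proof -
    have "(\<integral>\<^sup>+x. (\<Sum>n. ennreal (2^n * (s (Suc n) x - s n x)\<^sup>2)) \<partial>N)
        = (\<Sum>n. ennreal (2^n) * (\<integral>\<^sup>+x. ennreal ((s (Suc n) x - s n x)\<^sup>2) \<partial>N))"
      by (subst nn_integral_suminf) (auto simp: ennreal_mult nn_integral_cmult)
    also have "\<dots> \<le> (\<Sum>n. ennreal ((1/2)^n))"
    proof (intro suminf_le)
      fix n
      have "ennreal (2^n) * (\<integral>\<^sup>+x. ennreal ((s (Suc n) x - s n x)\<^sup>2) \<partial>N)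
          \<le> ennreal (2^n) * ennreal (e n)"
        by (intro mult_left_mono step) simp
      also have "\<dots> = ennreal ((1/2)^n)"
        by (simp add: e_def ennreal_mult[symmetric] power_mult_distrib[symmetric])
      finally show "ennreal (2^n) * (\<integral>\<^sup>+x. ennreal ((s (Suc n) x - s n x)\<^sup>2) \<partial>N)
          \<le> ennreal ((1/2)^n)" .
    qed auto
    also have "\<dots> = ennreal (\<Sum>n. (1/2)^n)"
      by (intro suminf_ennreal2) (auto intro!: summable_geometric)
    finally have "(\<integral>\<^sup>+x. (\<Sum>n. ennreal (2^n * (s (Suc n) x - s n x)\<^sup>2)) \<partial>N) \<noteq> \<infinity>"
      by (auto simp: top_unique)
    then have "AE x in N. (\<Sum>n. ennreal (2^n * (s (Suc n) x - s n x)\<^sup>2)) \<noteq> \<infinity>"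
      by (intro nn_integral_PInf_AE) auto
    then show ?thesis
    proof eventually_elim
      fix x assume "(\<Sum>n. ennreal (2^n * (s (Suc n) x - s n x)\<^sup>2)) \<noteq> \<infinity>"
      then have "summable (\<lambda>n. 2^n * (s (Suc n) x - s n x)\<^sup>2)"
        by (intro summable_suminf_not_top) auto
      moreover have "summable (\<lambda>n. (1/2::real)^n)" by (rule summable_geometric) simp
      ultimately have S: "summable (\<lambda>n. 2^n * (s (Suc n) x - s n x)\<^sup>2 + (1/2)^n)"
        by (rule summable_add)
      have "summable (\<lambda>n. s (Suc n) x - s n x)"
      proof (rule summable_comparison_test'[OF S])
        fix n :: nat
        define r where "r = \<bar>s (Suc n) x - s n x\<bar>"
        have pos: "(2::real)^n > 0" by simp
        \<comment> \<open>the arithmetic-geometric mean inequality for \<open>2^n * r^2\<close> and \<open>2^-n\<close>\<close>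
        have "2 * r \<le> 2^n * r\<^sup>2 + (1/2)^n"
        proof -
          have "0 \<le> (2^n * r - 1)\<^sup>2 / 2^n" by simp
          also have "\<dots> = 2^n * r\<^sup>2 - 2 * r + (1/2)^n"
            using pos by (simp add: power2_eq_square field_simps power_one_over)
          finally show ?thesis by simp
        qed
        moreover have "0 \<le> r" by (simp add: r_def)
        ultimately have "r \<le> 2^n * r\<^sup>2 + (1/2)^n" by linarith
        then show "norm (s (Suc n) x - s n x) \<le> 2^n * (s (Suc n) x - s n x)\<^sup>2 + (1/2)^n"
          by (simp add: r_def)
      qed
      then have "convergent (\<lambda>n. \<Sum>i<n. s (Suc i) x - s i x)"
        by (simp add: summable_iff_convergent)
      then have "convergent (\<lambda>n. s n x - s 0 x)"
        unfolding sum_lessThan_telescope[of "\<lambda>i. s i x"] .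
      then show "convergent (\<lambda>n. s n x)"
        by (simp only: convergent_diff_const_right_iff)
    qed
  qed
  show ?thesis
  proof (intro exI[of _ s] conjI allI impI sK conv)
    have "(\<integral>\<^sup>+x. ennreal ((lim (\<lambda>n. s n x))\<^sup>2) \<partial>N)
        = (\<integral>\<^sup>+x. liminf (\<lambda>n. ennreal ((s n x)\<^sup>2)) \<partial>N)"
    proof (rule nn_integral_cong_AE, use conv in eventually_elim)
      fix x assume "convergent (\<lambda>n. s n x)"
      then have "(\<lambda>n. ennreal ((s n x)\<^sup>2)) \<longlonglongrightarrow> ennreal ((lim (\<lambda>n. s n x))\<^sup>2)"
        by (intro tendsto_ennrealI tendsto_power) (simp add: convergent_LIMSEQ_iff)
      then show "ennreal ((lim (\<lambda>n. s n x))\<^sup>2) = liminf (\<lambda>n. ennreal ((s n x)\<^sup>2))"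
        by (intro lim_imp_Liminf[symmetric]) auto
    qed
    also have "\<dots> \<le> liminf (\<lambda>n. \<integral>\<^sup>+x. ennreal ((s n x)\<^sup>2) \<partial>N)"
      by (rule nn_integral_liminf) auto
    also have "\<dots> \<le> liminf (\<lambda>n::nat. ennreal (d + 1))"
    proof (intro Liminf_mono always_eventually allI)
      fix n
      have "I (s n) \<le> d + 1" using sI_le[of n] e(1,3)[of n] by argo
      then show "(\<integral>\<^sup>+x. ennreal ((s n x)\<^sup>2) \<partial>N) \<le> ennreal (d + 1)"
        using int[OF sK[of n]] by (subst nn_integral_eq_integral) (auto simp: I_def intro: ennreal_leI)
    qed
    also have "\<dots> < \<infinity>" by (simp add: Liminf_const)
    finally show "(\<integral>\<^sup>+x. ennreal ((lim (\<lambda>n. s n x))\<^sup>2) \<partial>N) < \<infinity>" .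
  next
    fix T :: "('b \<Rightarrow> real) \<Rightarrow> 'b \<Rightarrow> real"
    assume *: "\<forall>u\<in>K. T u \<in> K \<and> (\<integral>x. (T u x)\<^sup>2 \<partial>N) = (\<integral>x. (u x)\<^sup>2 \<partial>N)"
    have T: "T u \<in> K \<and> (\<integral>x. (T u x)\<^sup>2 \<partial>N) = (\<integral>x. (u x)\<^sup>2 \<partial>N)" if "u \<in> K" for u
      using * that by simp
    have le: "(\<integral>\<^sup>+x. ennreal ((T (s n) x - s n x)\<^sup>2) \<partial>N) \<le> ennreal (e n)" for n
    proof -
      have "I (T (s n)) = I (s n)" using T[OF sK] by (simp add: I_def)
      then have "2 * (I (T (s n)) - d) + 2 * (I (s n) - d) \<le> e n"
        using sI_le[of n] e(1)[of n] by argo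
      then show ?thesis
        using nn[of "T (s n)" "s n"] T[OF sK] sK by (meson ennreal_leI order_trans)
    qed
    have lim: "(\<lambda>n. ennreal (e n)) \<longlonglongrightarrow> 0"
      unfolding e_def using tendsto_ennrealI[OF LIMSEQ_power_zero[of "1/4::real"]] by simp
    show "(\<lambda>n. \<integral>\<^sup>+x. ennreal ((T (s n) x - s n x)\<^sup>2) \<partial>N) \<longlonglongrightarrow> 0"
      by (rule tendsto_sandwich[OF _ _ tendsto_const lim]) (simp_all add: le)
  qed
qed

section \<open>Invariant sets of finite covolume\<close>

text \<open>
  Here \<open>D\<close> represents the quotient by \<open>H\<close>, and the inner product of \<open>u\<close> and \<open>v\<close> is the integral of \<open>u v\<close>
  over \<open>D\<close>. The lower bound on the overlaps of \<open>B\<close> with the translates of \<open>A\<close> prevents the minimal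
  vector from being zero.
\<close>

lemma invariant_set_of_finite_covolume:
  assumes actG: "mp_action G W a" and actH: "mp_action H W b" and cH: "countable (carrier H)"
    and comm: "\<And>g h w. \<lbrakk>g \<in> carrier G; h \<in> carrier H; w \<in> space W\<rbrakk> \<Longrightarrow> a g (b h w) = b h (a g w)"
    and [measurable]: "D \<in> sets W" "A \<in> sets W" "B \<in> sets W"
    and D: "AE w in W. \<exists>!d. d \<in> carrier H \<and> b d w \<in> D"
    and A: "\<And>d w. \<lbrakk>d \<in> carrier H; w \<in> space W\<rbrakk> \<Longrightarrow> b d w \<in> A \<longleftrightarrow> w \<in> A"
    and finA: "emeasure W (A \<inter> D) < \<infinity>" and finB: "emeasure W (B \<inter> D) < \<infinity>"
    and c: "c > 0"
    and le: "\<And>g. g \<in> carrier G \<Longrightarrow> ennreal c \<le> emeasure W {w \<in> space W. a g w \<in> A \<and> w \<in> B \<and> w \<in> D}"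
  shows "\<exists>V \<in> sets W. (\<forall>g \<in> carrier G. AE w in W. a g w \<in> V \<longleftrightarrow> w \<in> V) \<and>
    (\<forall>d \<in> carrier H. \<forall>w \<in> space W. b d w \<in> V \<longleftrightarrow> w \<in> V) \<and>
    emeasure W V \<noteq> 0 \<and> emeasure W (V \<inter> D) < \<infinity>"
proof -
  interpret G: group G using actG by (rule mp_action_group)
  note mG[measurable] = mp_action_measurable[OF actG]
  \<comment> \<open>\<open>N\<close> is the measure on the quotient by \<open>H\<close>, realised on the transversal \<open>D\<close>\<close>
  define N where "N = density W (indicator D)"
  have sN[measurable_cong]: "sets N = sets W" and spN: "space N = space W" by (simp_all add: N_def)
  have nnN: "(\<integral>\<^sup>+w. u w \<partial>N) = (\<integral>\<^sup>+w. u w * indicator D w \<partial>W)" if "u \<in> borel_measurable W" for u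
    unfolding N_def using that by (subst nn_integral_density) (auto simp: mult.commute)
  have emN: "emeasure N X = emeasure W (X \<inter> D)" if "X \<in> sets W" for X
    unfolding N_def using that by (subst emeasure_density) (auto simp flip: indicator_inter_arith simp: Int_commute)
  have AEN: "(AE w in N. P w) \<longleftrightarrow> (AE w in W. w \<in> D \<longrightarrow> P w)" for P
    unfolding N_def by (subst AE_density) (auto simp: indicator_def)
  have D_meets: "AE w in W. \<exists>d \<in> carrier H. b d w \<in> D"
    using D by eventually_elim blast
  note from_D = AE_invariant_from_transversal[OF actH cH _ D_meets]
  have finNB: "emeasure N B < \<infinity>" using finB by (simp add: emN)
  have bound_int: "integrable N (\<lambda>w. u w * indicator B w)"
    if [measurable]: "u \<in> borel_measurable W" and "\<And>w. 0 \<le> u w" "\<And>w. u w \<le> 1" for u :: "_ \<Rightarrow> real"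
  proof (rule Bochner_Integration.integrable_bound)
    show "integrable N (indicator B :: _ \<Rightarrow> real)" using finNB by simp
    show "AE w in N. norm (u w * indicator B w) \<le> norm (indicator B w :: real)"
      using that by (auto simp: indicator_def)
  qed measurable
  \<comment> \<open>quantifying over all translates makes \<open>K\<close> invariant under \<open>G\<close> without forming a convex hull\<close>
  define K where "K = {u. u \<in> borel_measurable W \<and> (\<forall>w. 0 \<le> u w \<and> u w \<le> (1::real)) \<and>
     (\<forall>d\<in>carrier H. \<forall>w\<in>space W. u (b d w) = u w) \<and> integrable N (\<lambda>w. (u w)\<^sup>2) \<and>
     (\<forall>g\<in>carrier G. c \<le> (\<integral>w. u (a g w) * indicator B w \<partial>N))}"
  have Kmeas[measurable_dest]: "u \<in> borel_measurable W" if "u \<in> K" for u using that by (simp add: K_def)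
  have Kbd: "0 \<le> u w" "u w \<le> 1" if "u \<in> K" for u w using that by (simp_all add: K_def)
  have Kinv: "u (b d w) = u w" if "u \<in> K" "d \<in> carrier H" "w \<in> space W" for u d w
    using that by (simp add: K_def)
  have Kint: "integrable N (\<lambda>w. (u w)\<^sup>2)" if "u \<in> K" for u using that by (simp add: K_def)
  have Kc: "c \<le> (\<integral>w. u (a g w) * indicator B w \<partial>N)" if "u \<in> K" "g \<in> carrier G" for u g
    using that by (simp add: K_def)
  have KA: "indicator A \<in> K"
    unfolding K_def
  proof (intro CollectI conjI ballI)
    have "integrable N (indicator A :: _ \<Rightarrow> real)" using finA by (simp add: emN)
    moreover have "(\<lambda>w. (indicator A w :: real)\<^sup>2) = indicator A" by (auto simp: indicator_def)
    ultimately show "integrable N (\<lambda>w. (indicator A w :: real)\<^sup>2)" by simp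
    fix g assume g[simp]: "g \<in> carrier G"
    let ?C = "{w \<in> space W. a g w \<in> A \<and> w \<in> B}"
    have C[measurable]: "?C \<in> sets W" by measurable
    have "(\<integral>w. (indicator A (a g w) :: real) * indicator B w \<partial>N) = (\<integral>w. indicator ?C w \<partial>N)"
      by (intro Bochner_Integration.integral_cong) (auto simp: indicator_def spN)
    also have "\<dots> = measure N ?C" by (simp add: Int_absorb2 spN)
    finally have 1: "(\<integral>w. (indicator A (a g w) :: real) * indicator B w \<partial>N) = measure N ?C" .
    have "emeasure N ?C \<le> emeasure N B" by (intro emeasure_mono) auto
    then have "emeasure N ?C = ennreal (measure N ?C)"
      using finNB by (intro emeasure_eq_ennreal_measure) (auto simp: top_unique)
    moreover have "?C \<inter> D = {w \<in> space W. a g w \<in> A \<and> w \<in> B \<and> w \<in> D}" by auto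
    ultimately have "ennreal c \<le> ennreal (measure N ?C)"
      using le[OF g] emN[OF C] by simp
    then show "c \<le> (\<integral>w. (indicator A (a g w) :: real) * indicator B w \<partial>N)"
      unfolding 1 by (simp add: ennreal_le_iff)
  qed (use A in \<open>auto simp: indicator_def\<close>)
  have Kmid: "(\<lambda>w. (u w + v w) / 2) \<in> K" if uv: "u \<in> K" "v \<in> K" for u v
    unfolding K_def
  proof (intro CollectI conjI ballI allI)
    note [measurable] = Kmeas[OF uv(1)] Kmeas[OF uv(2)]
    show "(\<lambda>w. (u w + v w) / 2) \<in> borel_measurable W" by measurable
    show "0 \<le> (u w + v w) / 2" "(u w + v w) / 2 \<le> 1" for w
      using Kbd[OF uv(1), of w] Kbd[OF uv(2), of w] by auto
    show "(u (b d w) + v (b d w)) / 2 = (u w + v w) / 2" if "d \<in> carrier H" "w \<in> space W" for d w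
      using Kinv[OF uv(1) that] Kinv[OF uv(2) that] by simp
    have le: "((x + y) / 2)\<^sup>2 \<le> x\<^sup>2 + y\<^sup>2" for x y :: real
    proof -
      have "0 \<le> (x - y)\<^sup>2 + 2 * (x\<^sup>2 + y\<^sup>2)" by simp
      then show ?thesis by (simp add: power2_eq_square field_simps)
    qed
    show "integrable N (\<lambda>w. ((u w + v w) / 2)\<^sup>2)"
      by (rule Bochner_Integration.integrable_bound[OF Bochner_Integration.integrable_add[OF Kint[OF uv(1)] Kint[OF uv(2)]]])
        (use le in \<open>auto intro!: AE_I2\<close>)
    fix g assume g[simp]: "g \<in> carrier G"
    have "(\<integral>w. (u (a g w) + v (a g w)) / 2 * indicator B w \<partial>N)
        = (\<integral>w. (u (a g w) * indicator B w + v (a g w) * indicator B w) / 2 \<partial>N)"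
      by (intro Bochner_Integration.integral_cong) (auto simp: field_simps)
    also have "\<dots> = ((\<integral>w. u (a g w) * indicator B w \<partial>N) + (\<integral>w. v (a g w) * indicator B w \<partial>N)) / 2"
      using bound_int[of "\<lambda>w. u (a g w)"] bound_int[of "\<lambda>w. v (a g w)"]
        Kbd[OF uv(1)] Kbd[OF uv(2)] by simp
    finally have eq: "(\<integral>w. (u (a g w) + v (a g w)) / 2 * indicator B w \<partial>N) = \<dots>" .
    have "c \<le> (x + y) / 2" if "c \<le> x" "c \<le> y" for x y
      using that by simp
    then show "c \<le> (\<integral>w. (u (a g w) + v (a g w)) / 2 * indicator B w \<partial>N)"
      unfolding eq using Kc[OF uv(1) g] Kc[OF uv(2) g] by blast
  qed
  have shift: "(\<lambda>w. u (a g w)) \<in> K \<and> (\<integral>w. (u (a g w))\<^sup>2 \<partial>N) = (\<integral>w. (u w)\<^sup>2 \<partial>N)"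
    if u: "u \<in> K" and g[simp]: "g \<in> carrier G" for u g
  proof -
    note [measurable] = Kmeas[OF u]
    have nn: "(\<integral>\<^sup>+w. ennreal ((u (a g w))\<^sup>2) \<partial>N) = (\<integral>\<^sup>+w. ennreal ((u w)\<^sup>2) \<partial>N)"
      using nn_integral_translate_mod[OF actG actH cH comm _ _ D _ g, of "\<lambda>w. ennreal ((u w)\<^sup>2)"]
        Kinv[OF u] by (simp add: nnN)
    have int: "integrable N (\<lambda>w. (u (a g w))\<^sup>2)"
      using Kint[OF u] nn by (simp add: integrable_iff_bounded)
    have "(\<integral>w. (u (a g w))\<^sup>2 \<partial>N) = (\<integral>w. (u w)\<^sup>2 \<partial>N)"
      using nn by (simp add: integral_eq_nn_integral)
    moreover have "(\<lambda>w. u (a g w)) \<in> K"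
      unfolding K_def
    proof (intro CollectI conjI ballI allI)
      show "u (a g (b d w)) = u (a g w)" if "d \<in> carrier H" "w \<in> space W" for d w
        using that comm[OF g that] Kinv[OF u that(1) mp_action_closed[OF actG g that(2)]] by simp
      fix h assume h: "h \<in> carrier G"
      have "(\<integral>w. u (a g (a h w)) * indicator B w \<partial>N) = (\<integral>w. u (a (g \<otimes>\<^bsub>G\<^esub> h) w) * indicator B w \<partial>N)"
        using mp_action_mult[OF actG g h] by (intro Bochner_Integration.integral_cong) (auto simp: spN)
      then show "c \<le> (\<integral>w. u (a g (a h w)) * indicator B w \<partial>N)"
        using Kc[OF u, of "g \<otimes>\<^bsub>G\<^esub> h"] h by simp
    qed (use Kbd[OF u] int in auto)
    ultimately show ?thesis by simp
  qed
  have K_ne: "K \<noteq> {}" using KA by blast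
  have KmeasN: "u \<in> borel_measurable N" if "u \<in> K" for u
    using Kmeas[OF that] by (simp add: measurable_cong_sets[OF sN refl])
  obtain s where s: "\<forall>n::nat. s n \<in> K"
    and conv: "AE w in N. convergent (\<lambda>n. s n w)"
    and fin: "(\<integral>\<^sup>+w. ennreal ((lim (\<lambda>n. s n w))\<^sup>2) \<partial>N) < \<infinity>"
    and ai: "\<forall>T. (\<forall>u\<in>K. T u \<in> K \<and> (\<integral>x. (T u x)\<^sup>2 \<partial>N) = (\<integral>x. (u x)\<^sup>2 \<partial>N)) \<longrightarrow>
           (\<lambda>n. \<integral>\<^sup>+x. ennreal ((T (s n) x - s n x)\<^sup>2) \<partial>N) \<longlonglongrightarrow> 0"
    by (rule exE[OF L2_minimising_sequence[OF K_ne KmeasN Kint Kmid]], assumption+, elim conjE, rule that)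
  have sK: "s n \<in> K" for n using s by simp
  note [measurable] = Kmeas[OF sK]
  define f where "f w = lim (\<lambda>n. s n w)" for w
  have [measurable]: "f \<in> borel_measurable W" unfolding f_def[abs_def] by measurable
  have f_H: "f (b d w) = f w" if "d \<in> carrier H" "w \<in> space W" for d w
    using Kinv[OF sK that] by (simp add: f_def)
  have "AE w in W. convergent (\<lambda>n. s n w)"
  proof (rule from_D)
    show "convergent (\<lambda>n. s n w)" if "d \<in> carrier H" "w \<in> space W" "convergent (\<lambda>n. s n (b d w))" for d w
      using that(3) by (simp add: Kinv[OF sK that(1,2)])
    show "AE w in W. w \<in> D \<longrightarrow> convergent (\<lambda>n. s n w)"
      using conv by (simp add: AEN)
  qed
  then have lim: "AE w in W. (\<lambda>n. s n w) \<longlonglongrightarrow> f w"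
    by eventually_elim (simp add: f_def convergent_LIMSEQ_iff)
  then have limN: "AE w in N. (\<lambda>n. s n w) \<longlonglongrightarrow> f w"
    unfolding AEN by eventually_elim simp
  have f_G: "AE w in W. f (a g w) = f w" if g[simp]: "g \<in> carrier G" for g
  proof (rule from_D)
    have "AE w in N. (\<lambda>n. s n (a g w)) \<longlonglongrightarrow> f (a g w)"
      using mp_action_AE[OF actG g lim] unfolding AEN by eventually_elim simp
    with limN have "(\<integral>\<^sup>+w. ennreal ((f (a g w) - f w)\<^sup>2) \<partial>N)
        = (\<integral>\<^sup>+w. liminf (\<lambda>n. ennreal ((s n (a g w) - s n w)\<^sup>2)) \<partial>N)"
      by (intro nn_integral_cong_AE, eventually_elim)
        (intro lim_imp_Liminf[symmetric] tendsto_ennrealI tendsto_power tendsto_diff, auto)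
    also have "\<dots> \<le> liminf (\<lambda>n. \<integral>\<^sup>+w. ennreal ((s n (a g w) - s n w)\<^sup>2) \<partial>N)"
      by (rule nn_integral_liminf) auto
    also have "\<dots> = 0"
      using ai[rule_format, of "\<lambda>u w. u (a g w)"] shift[OF _ g] by (intro lim_imp_Liminf) auto
    finally have "AE w in N. ennreal ((f (a g w) - f w)\<^sup>2) = 0"
      by (subst (asm) le_zero_eq, subst (asm) nn_integral_0_iff_AE) auto
    then show "AE w in W. w \<in> D \<longrightarrow> f (a g w) = f w"
      unfolding AEN by eventually_elim simp
    show "f (a g w) = f w" if "d \<in> carrier H" "w \<in> space W" "f (a g (b d w)) = f (b d w)" for d w
      using that f_H[OF that(1,2)] f_H[OF that(1) mp_action_closed[OF actG g that(2)]] comm[OF g that(1,2)]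
      by simp
  qed
  have f_bd: "AE w in N. 0 \<le> f w \<and> f w \<le> 1"
    using limN
  proof eventually_elim
    fix w assume "(\<lambda>n. s n w) \<longlonglongrightarrow> f w"
    then show "0 \<le> f w \<and> f w \<le> 1"
      using Kbd[OF sK] by (auto intro: LIMSEQ_le_const LIMSEQ_le_const2)
  qed
  have lim_int: "(\<lambda>n. \<integral>w. s n w * indicator B w \<partial>N) \<longlonglongrightarrow> (\<integral>w. f w * indicator B w \<partial>N)"
  proof (rule integral_dominated_convergence[where w = "indicator B"])
    show "integrable N (indicator B :: _ \<Rightarrow> real)" using finNB by simp
    show "AE w in N. (\<lambda>n. s n w * indicator B w) \<longlonglongrightarrow> f w * indicator B w"
      using limN by eventually_elim (intro tendsto_intros)
    show "AE w in N. norm (s n w * indicator B w) \<le> indicator B w" for n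
      using Kbd[OF sK] by (auto simp: indicator_def)
  qed measurable
  have s_c: "c \<le> (\<integral>w. s n w * indicator B w \<partial>N)" for n
  proof -
    have "(\<integral>w. s n (a \<one>\<^bsub>G\<^esub> w) * indicator B w \<partial>N) = (\<integral>w. s n w * indicator B w \<partial>N)"
      using mp_action_one[OF actG] by (intro Bochner_Integration.integral_cong) (auto simp: spN)
    then show ?thesis using Kc[OF sK, of "\<one>\<^bsub>G\<^esub>" n] by simp
  qed
  have f_c: "c \<le> (\<integral>w. f w * indicator B w \<partial>N)"
    using lim_int s_c by (intro LIMSEQ_le_const) auto
  \<comment> \<open>small enough that \<open>f \<le> t\<close> would give an integral over \<open>B\<close> of at most \<open>c / 2\<close>\<close>
  define t where "t = c / (2 * (measure N B + 1))"
  have t: "t > 0" using c by (simp add: t_def add_nonneg_pos)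
  define V where "V = {w \<in> space W. f w > t}"
  have V[measurable]: "V \<in> sets W" unfolding V_def by measurable
  show ?thesis
  proof (intro bexI[OF _ V] conjI ballI)
    show "AE w in W. (a g w \<in> V) = (w \<in> V)" if "g \<in> carrier G" for g
      using f_G[OF that] AE_space
      by eventually_elim (use mp_action_closed[OF actG that] in \<open>auto simp: V_def\<close>)
    show "(b d w \<in> V) = (w \<in> V)" if "d \<in> carrier H" "w \<in> space W" for d w
      using f_H[OF that] mp_action_closed[OF actH that] that by (simp add: V_def)
    show "emeasure W V \<noteq> 0"
    proof
      assume "emeasure W V = 0"
      then have "AE w in W. w \<notin> V" by (intro AE_not_in) auto
      with AE_space have "AE w in W. f w \<le> t" by eventually_elim (auto simp: V_def)
      then have "AE w in N. f w \<le> t" unfolding AEN by eventually_elim simp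
      then have "(\<integral>w. f w * indicator B w \<partial>N) \<le> (\<integral>w. t * indicator B w \<partial>N)"
      proof (intro integral_mono_AE)
        show "integrable N (\<lambda>w. f w * indicator B w)"
        proof (rule Bochner_Integration.integrable_bound)
          show "integrable N (indicator B :: _ \<Rightarrow> real)" using finNB by simp
          show "AE w in N. norm (f w * indicator B w) \<le> norm (indicator B w :: real)"
            using f_bd by eventually_elim (auto simp: indicator_def)
        qed measurable
        show "integrable N (\<lambda>w. t * indicator B w)" using finNB by simp
        show "AE w in N. f w * indicator B w \<le> t * indicator B w" if "AE w in N. f w \<le> t"
          using that by eventually_elim (auto simp: indicator_def)
      qed
      also have "\<dots> = t * measure N B" by (simp add: Int_absorb2 sets.sets_into_space spN)
      also have "\<dots> \<le> c / 2"
      proof -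
        have "0 < measure N B + 1" by (simp add: add_nonneg_pos)
        then have "measure N B / (measure N B + 1) \<le> 1" by simp
        then have "c / 2 * (measure N B / (measure N B + 1)) \<le> c / 2 * 1"
          using c by (intro mult_left_mono) auto
        then show ?thesis by (simp add: t_def)
      qed
      finally show False using f_c c by linarith
    qed
    have "emeasure W (V \<inter> D) = (\<integral>\<^sup>+w. indicator V w \<partial>N)"
      by (simp add: emN)
    also have "\<dots> \<le> (\<integral>\<^sup>+w. ennreal (1 / t\<^sup>2) * ennreal ((f w)\<^sup>2) \<partial>N)"
    proof (intro nn_integral_mono)
      fix w
      show "indicator V w \<le> ennreal (1 / t\<^sup>2) * ennreal ((f w)\<^sup>2)"
      proof (cases "w \<in> V")
        case True
        then have "t\<^sup>2 \<le> (f w)\<^sup>2" using t by (intro power_mono) (auto simp: V_def)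
        then have "1 \<le> 1 / t\<^sup>2 * (f w)\<^sup>2" using t by simp
        then show ?thesis using True t by (simp flip: ennreal_mult ennreal_1)
      qed simp
    qed
    also have "\<dots> = ennreal (1 / t\<^sup>2) * (\<integral>\<^sup>+w. ennreal ((f w)\<^sup>2) \<partial>N)"
      by (rule nn_integral_cmult) measurable
    also have "\<dots> < \<infinity>"
      using fin by (simp add: f_def ennreal_mult_less_top)
    finally show "emeasure W (V \<inter> D) < \<infinity>" .
  qed
qed

section \<open>Moving a coupling to the real line\<close>

definition transported_action :: "'b measure \<Rightarrow> ('b \<Rightarrow> 'c) \<Rightarrow> ('g \<Rightarrow> 'b \<Rightarrow> 'b) \<Rightarrow> 'g \<Rightarrow> 'c \<Rightarrow> 'c" where
  "transported_action W f a g = (\<lambda>r \<in> f ` space W. f (a g (the_inv_into (space W) f r)))"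

lemma transported_action_apply:
  "inj_on f (space W) \<Longrightarrow> w \<in> space W \<Longrightarrow> transported_action W f a g (f w) = f (a g w)"
  by (simp add: transported_action_def the_inv_into_f_f)

lemma mp_action_transported:
  assumes act: "mp_action G W a" and inj: "inj_on f (space W)"
  shows "mp_action G (embed_measure W f) (transported_action W f a)"
proof (rule mp_actionI)
  note app = transported_action_apply[OF inj]
  note fm = measurable_embed_measure2'[OF inj]
  show "group G" using act by (rule mp_action_group)
  fix g assume g: "g \<in> carrier G"
  note ag = mp_action_measurable[OF act g] and cl = mp_action_closed[OF act g]
  show meas: "transported_action W f a g \<in> measurable (embed_measure W f) (embed_measure W f)"
  proof (rule measurable_embed_measure1)
    have "(\<lambda>w. f (a g w)) \<in> measurable W (embed_measure W f)"
      using ag fm by measurable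
    then show "(\<lambda>w. transported_action W f a g (f w)) \<in> measurable W (embed_measure W f)"
      by (subst measurable_cong[OF app])
  qed
  show "transported_action W f a g \<in> extensional (space (embed_measure W f))"
    by (simp add: transported_action_def space_embed_measure)
  show "transported_action W f a (g \<otimes>\<^bsub>G\<^esub> h) r = transported_action W f a g (transported_action W f a h r)"
    if h: "h \<in> carrier G" and "r \<in> space (embed_measure W f)" for h r
    using that mp_action_closed[OF act h] by (auto simp: space_embed_measure app mp_action_mult[OF act g h])
  show "emeasure (embed_measure W f) (transported_action W f a g -` A \<inter> space (embed_measure W f))
      = emeasure (embed_measure W f) A" if A: "A \<in> sets (embed_measure W f)" for A
  proof -
    have fA: "f -` A \<inter> space W \<in> sets W" using measurable_sets[OF fm A] .
    have "emeasure (embed_measure W f) (transported_action W f a g -` A \<inter> space (embed_measure W f))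
        = emeasure W (f -` (transported_action W f a g -` A \<inter> space (embed_measure W f)) \<inter> space W)"
      using measurable_sets[OF meas A] by (rule emeasure_embed_measure'[OF inj])
    also have "f -` (transported_action W f a g -` A \<inter> space (embed_measure W f)) \<inter> space W
        = a g -` (f -` A \<inter> space W) \<inter> space W"
    proof (rule Set.set_eqI)
      fix w
      show "w \<in> f -` (transported_action W f a g -` A \<inter> space (embed_measure W f)) \<inter> space W
          \<longleftrightarrow> w \<in> a g -` (f -` A \<inter> space W) \<inter> space W"
        using cl[of w] by (cases "w \<in> space W") (simp_all add: space_embed_measure app)
    qed
    also have "emeasure W \<dots> = emeasure W (f -` A \<inter> space W)"
    proof -
      have "\<forall>B\<in>sets W. emeasure W (a g -` B \<inter> space W) = emeasure W B"
        using act g by (simp add: mp_action_def aut_def)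
      then show ?thesis using fA by (rule bspec)
    qed
    also have "\<dots> = emeasure (embed_measure W f) A"
      using A by (rule emeasure_embed_measure'[OF inj, symmetric])
    finally show ?thesis .
  qed
qed (auto simp: space_embed_measure transported_action_apply[OF inj] mp_action_one[OF act])

lemma orbit_transported:
  "inj_on f (space W) \<Longrightarrow> w \<in> space W \<Longrightarrow>
    orbit G (transported_action W f a) (f w) = f ` orbit G a w"
  by (auto simp: orbit_def transported_action_apply)

lemma free_action_transported:
  assumes act: "mp_action G W a" and inj: "inj_on f (space W)" and free: "free_action G W a"
  shows "free_action G (embed_measure W f) (transported_action W f a)"
proof -
  have "stabilizer G (transported_action W f a) (f w) = stabilizer G a w" if w: "w \<in> space W" for w
  proof -
    have "f (a g w) = f w \<longleftrightarrow> a g w = w" if "g \<in> carrier G" for g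
      using inj w mp_action_closed[OF act that w] by (simp add: inj_on_eq_iff)
    then show ?thesis
      by (auto simp: stabilizer_def transported_action_apply[OF inj w])
  qed
  then show ?thesis
    using free AE_space[of W] unfolding free_action_def AE_embed_measure'[OF inj]
    by (auto elim: eventually_elim2)
qed

lemma fundamental_domain_transported:
  assumes act: "mp_action G W a" and inj: "inj_on f (space W)" and D: "fundamental_domain G W a D"
  shows "fundamental_domain G (embed_measure W f) (transported_action W f a) (f ` D)"
proof -
  have DW: "D \<in> sets W" "D \<subseteq> space W"
    using D sets.sets_into_space by (auto simp: fundamental_domain_def)
  have "AE w in W. \<exists>!y. y \<in> D \<inter> orbit G a w"
    using D by (simp add: fundamental_domain_def)
  then have "AE w in W. \<exists>!y. y \<in> f ` D \<inter> orbit G (transported_action W f a) (f w)"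
    using AE_space
  proof eventually_elim
    fix w assume ex: "\<exists>!y. y \<in> D \<inter> orbit G a w" and w: "w \<in> space W"
    have "f ` D \<inter> orbit G (transported_action W f a) (f w) = f ` (D \<inter> orbit G a w)"
      unfolding orbit_transported[OF inj w]
      using inj_on_image_Int[OF inj DW(2) mp_action_orbit_subset[OF act w]] by simp
    moreover obtain y where "D \<inter> orbit G a w = {y}"
      using ex by (metis (no_types, lifting) is_singletonI' is_singleton_def ex1_implies_ex empty_iff)
    ultimately show "\<exists>!y. y \<in> f ` D \<inter> orbit G (transported_action W f a) (f w)" by simp
  qed
  then show ?thesis
    unfolding fundamental_domain_def AE_embed_measure'[OF inj]
    using in_sets_embed_measure[OF DW(1)] by simp
qed

lemma sigma_finite_embed_measure_inj_on:
  assumes "sigma_finite_measure M" and inj: "inj_on f (space M)"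
  shows "sigma_finite_measure (embed_measure M f)"
proof -
  from assms(1) interpret sigma_finite_measure M .
  obtain \<A> where \<A>: "countable \<A>" "\<A> \<subseteq> sets M" "\<Union>\<A> = space M" "\<And>X. X \<in> \<A> \<Longrightarrow> emeasure M X \<noteq> \<infinity>"
    using sigma_finite_countable by blast
  have "emeasure (embed_measure M f) (f ` X) \<noteq> \<infinity>" if "X \<in> \<A>" for X
    using that \<A> inj by (subst emeasure_embed_measure_image') auto
  moreover have "\<Union>((`) f ` \<A>) = space (embed_measure M f)"
    unfolding space_embed_measure \<A>(3)[symmetric] by blast
  ultimately show ?thesis
    using \<A>(1,2) by unfold_locales
      (intro exI[of _ "(`) f ` \<A>"], auto intro: in_sets_embed_measure)
qed

text \<open>
  Since a standard Borel space injects into the reals, a coupling on any type yields one on the reals.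
\<close>

lemma measure_equivalentI:
  fixes W :: "'b measure"
  assumes sb: "standard_borel W" and sf: "sigma_finite_measure W" and ne: "emeasure W (space W) \<noteq> 0"
    and a: "mp_action G W a" "free_action G W a" and b: "mp_action H W b" "free_action H W b"
    and comm: "\<And>g h x. \<lbrakk>g \<in> carrier G; h \<in> carrier H; x \<in> space W\<rbrakk> \<Longrightarrow> a g (b h x) = b h (a g x)"
    and D: "fundamental_domain G W a D" "emeasure W D < \<infinity>"
    and D': "fundamental_domain H W b D'" "emeasure W D' < \<infinity>"
  shows "measure_equivalent G H"
proof -
  obtain f :: "'b \<Rightarrow> real" where inj: "inj_on f (space W)"
    using standard_borel_inj_real[OF sb] .
  note app = transported_action_apply[OF inj]
  let ?W = "embed_measure W f" and ?a = "transported_action W f a" and ?b = "transported_action W f b"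
  have image: "emeasure ?W (f ` X) = emeasure W X" if "X \<in> sets W" for X
    using that inj by (simp add: emeasure_embed_measure_image')
  have "D \<in> sets W" "D' \<in> sets W"
    using D D' by (auto simp: fundamental_domain_def)
  then have fin: "emeasure ?W (f ` D) < \<infinity>" "emeasure ?W (f ` D') < \<infinity>"
    using D D' by (simp_all add: image)
  have "emeasure ?W (space ?W) \<noteq> 0"
    using ne image[of "space W"] by (simp add: space_embed_measure)
  moreover have "\<forall>g\<in>carrier G. \<forall>h\<in>carrier H. \<forall>x\<in>space ?W. ?a g (?b h x) = ?b h (?a g x)"
    using comm mp_action_closed[OF a(1)] mp_action_closed[OF b(1)]
    by (auto simp: space_embed_measure app)
  ultimately show ?thesis
    unfolding measure_equivalent_def
    using standard_borel_embed_measure[OF sb inj] sigma_finite_embed_measure_inj_on[OF sf inj]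
      mp_action_transported[OF a(1) inj] free_action_transported[OF a(1) inj a(2)]
      mp_action_transported[OF b(1) inj] free_action_transported[OF b(1) inj b(2)]
      fundamental_domain_transported[OF a(1) inj D(1)] fundamental_domain_transported[OF b(1) inj D'(1)] fin
    by (intro exI[of _ ?W] exI[of _ ?a] exI[of _ ?b] conjI) auto
qed

section \<open>The coupling space of a pair of nested orbit equivalence relations\<close>

text \<open>
  The hypotheses on freeness and on the inclusion of the orbit equivalence relations hold pointwise on a
  conull set \<open>X\<^sub>0\<close>. Its invariance under \<open>H\<close> is what the cocycle identity needs at every point.
\<close>

locale nested_actions =
  fixes G :: "('g, 'm) monoid_scheme" and H :: "('h, 'n) monoid_scheme"
    and M :: "'a measure" and a :: "'g \<Rightarrow> 'a \<Rightarrow> 'a" and b :: "'h \<Rightarrow> 'a \<Rightarrow> 'a"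
    and X\<^sub>0 :: "'a set"
  assumes cG: "countable (carrier G)" and cH: "countable (carrier H)"
    and sb: "standard_borel M" and prob: "prob_space M"
    and actG: "mp_action G M a" and actH: "mp_action H M b"
    and X\<^sub>0_sets[measurable]: "X\<^sub>0 \<in> sets M" and X\<^sub>0_AE: "AE x in M. x \<in> X\<^sub>0"
    and X\<^sub>0_inv: "\<And>d x. \<lbrakk>d \<in> carrier H; x \<in> space M\<rbrakk> \<Longrightarrow> b d x \<in> X\<^sub>0 \<longleftrightarrow> x \<in> X\<^sub>0"
    and freeG: "\<And>x. x \<in> X\<^sub>0 \<Longrightarrow> stabilizer G a x = {\<one>\<^bsub>G\<^esub>}"
    and freeH: "\<And>x. x \<in> X\<^sub>0 \<Longrightarrow> stabilizer H b x = {\<one>\<^bsub>H\<^esub>}"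
    and sub: "\<And>x. x \<in> X\<^sub>0 \<Longrightarrow> orbit H b x \<subseteq> orbit G a x"
begin

sublocale G: group G using actG by (rule mp_action_group)
sublocale H: group H using actH by (rule mp_action_group)
sublocale M: prob_space M by (rule prob)

sublocale GM: pair_sigma_finite "count_space (carrier G)" M
  using cG by (intro pair_sigma_finite.intro sigma_finite_measure_count_space_countable M.sigma_finite_measure_axioms)

lemmas a_meas = mp_action_measurable[OF actG] and b_meas = mp_action_measurable[OF actH]
lemmas a_closed = mp_action_closed[OF actG] and b_closed = mp_action_closed[OF actH]

lemma X\<^sub>0_space: "x \<in> X\<^sub>0 \<Longrightarrow> x \<in> space M"
  using sets.sets_into_space[OF X\<^sub>0_sets] by blast

lemma a_eqD: "\<lbrakk>x \<in> X\<^sub>0; g \<in> carrier G; h \<in> carrier G; a g x = a h x\<rbrakk> \<Longrightarrow> g = h"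
  using trivial_stabilizer_eqD[OF actG freeG X\<^sub>0_space] by blast

lemma b_eqD: "\<lbrakk>x \<in> X\<^sub>0; d \<in> carrier H; e \<in> carrier H; b d x = b e x\<rbrakk> \<Longrightarrow> d = e"
  using trivial_stabilizer_eqD[OF actH freeH X\<^sub>0_space] by blast

text \<open>
  The value \<open>\<one>\<close> outside \<open>X\<^sub>0\<close> keeps the skew action below an action everywhere.
\<close>

definition cocycle :: "'h \<Rightarrow> 'a \<Rightarrow> 'g" where
  "cocycle d x = (if x \<in> X\<^sub>0 then (THE g. g \<in> carrier G \<and> a g x = b d x) else \<one>\<^bsub>G\<^esub>)"

lemma cocycle_eqI:
  "\<lbrakk>x \<in> X\<^sub>0; g \<in> carrier G; a g x = b d x\<rbrakk> \<Longrightarrow> cocycle d x = g"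
  unfolding cocycle_def using a_eqD by (auto intro!: the_equality)

lemma cocycle_ex:
  assumes "x \<in> X\<^sub>0" "d \<in> carrier H"
  shows "\<exists>g \<in> carrier G. a g x = b d x"
proof -
  have "b d x \<in> orbit G a x" using sub[OF assms(1)] assms(2) by (auto simp: orbit_def)
  then show ?thesis by (auto simp: orbit_def)
qed

lemma cocycle_closed: "d \<in> carrier H \<Longrightarrow> cocycle d x \<in> carrier G"
  by (cases "x \<in> X\<^sub>0") (use cocycle_ex cocycle_eqI in \<open>fastforce, simp add: cocycle_def\<close>)

lemma cocycle_act: "\<lbrakk>x \<in> X\<^sub>0; d \<in> carrier H\<rbrakk> \<Longrightarrow> a (cocycle d x) x = b d x"
  using cocycle_ex cocycle_eqI by blast

text \<open>
  Outside \<open>X\<^sub>0\<close> the equation holds because \<open>X\<^sub>0\<close> is \<open>H\<close>-invariant, so that both sides are trivial; thus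
  the cocycle identity is exact and yields an action at every point.
\<close>

lemma cocycle_mult:
  assumes d: "d \<in> carrier H" "e \<in> carrier H" and x: "x \<in> space M"
  shows "cocycle (d \<otimes>\<^bsub>H\<^esub> e) x = cocycle d (b e x) \<otimes>\<^bsub>G\<^esub> cocycle e x"
proof (cases "x \<in> X\<^sub>0")
  case True
  then have "b e x \<in> X\<^sub>0" using X\<^sub>0_inv[OF d(2) x] by simp
  then have "a (cocycle d (b e x) \<otimes>\<^bsub>G\<^esub> cocycle e x) x = b (d \<otimes>\<^bsub>H\<^esub> e) x"
    using True x d by (simp add: mp_action_mult[OF actG] mp_action_mult[OF actH] cocycle_act cocycle_closed)
  then show ?thesis
    using True d by (intro cocycle_eqI) (auto simp: cocycle_closed)
next
  case False
  then show ?thesis using X\<^sub>0_inv[OF d(2) x] by (simp add: cocycle_def)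
qed

lemma cocycle_one: "x \<in> space M \<Longrightarrow> cocycle \<one>\<^bsub>H\<^esub> x = \<one>\<^bsub>G\<^esub>"
  using cocycle_eqI[of x "\<one>\<^bsub>G\<^esub>" "\<one>\<^bsub>H\<^esub>"]
  by (cases "x \<in> X\<^sub>0") (simp_all add: mp_action_one[OF actG] mp_action_one[OF actH] cocycle_def[of _ x])

lemma cocycle_measurable:
  assumes d: "d \<in> carrier H"
  shows "cocycle d \<in> measurable M (count_space (carrier G))"
proof (subst measurable_count_space_eq_countable[OF cG], intro conjI ballI)
  show "cocycle d \<in> space M \<rightarrow> carrier G" using cocycle_closed[OF d] by simp
  fix g assume g: "g \<in> carrier G"
  have [measurable]: "{x \<in> space M. a g x = b d x} \<in> sets M"
    using sb a_meas[OF g] b_meas[OF d] by (rule standard_borel_equaliser_measurable)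
  have "cocycle d -` {g} \<inter> space M
      = (X\<^sub>0 \<inter> {x \<in> space M. a g x = b d x}) \<union> {x \<in> space M. x \<notin> X\<^sub>0 \<and> g = \<one>\<^bsub>G\<^esub>}"
  proof (rule Set.set_eqI)
    fix x
    show "x \<in> cocycle d -` {g} \<inter> space M \<longleftrightarrow>
        x \<in> (X\<^sub>0 \<inter> {x \<in> space M. a g x = b d x}) \<union> {x \<in> space M. x \<notin> X\<^sub>0 \<and> g = \<one>\<^bsub>G\<^esub>}"
      using cocycle_act[OF _ d, of x] cocycle_eqI[OF _ g, of x d] X\<^sub>0_space
      by (cases "x \<in> X\<^sub>0") (auto simp: cocycle_def[of _ x])
  qed
  also have "\<dots> \<in> sets M" by measurable
  finally show "cocycle d -` {g} \<inter> space M \<in> sets M" .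
qed

text \<open>
  The point \<open>(g, x)\<close> stands for the pair \<open>(a g x, x)\<close> of \<open>G\<close>-equivalent points. The countable factor comes
  first, so that measurability can be checked slice by slice.
\<close>

definition \<Omega> :: "('g \<times> 'a) measure" where
  "\<Omega> = count_space (carrier G) \<Otimes>\<^sub>M M"

lemma space_\<Omega>: "space \<Omega> = carrier G \<times> space M"
  by (simp add: \<Omega>_def space_pair_measure)

definition left_action :: "'g \<Rightarrow> 'g \<times> 'a \<Rightarrow> 'g \<times> 'a" where
  "left_action h = (\<lambda>(g, x) \<in> space \<Omega>. (h \<otimes>\<^bsub>G\<^esub> g, x))"

definition skew_action :: "'h \<Rightarrow> 'g \<times> 'a \<Rightarrow> 'g \<times> 'a" where
  "skew_action d = (\<lambda>(g, x) \<in> space \<Omega>. (g \<otimes>\<^bsub>G\<^esub> inv\<^bsub>G\<^esub> cocycle d x, b d x))"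

lemma left_action_apply:
  "\<lbrakk>g \<in> carrier G; x \<in> space M\<rbrakk> \<Longrightarrow> left_action h (g, x) = (h \<otimes>\<^bsub>G\<^esub> g, x)"
  by (simp add: left_action_def space_\<Omega>)

lemma skew_action_apply:
  "\<lbrakk>g \<in> carrier G; x \<in> space M\<rbrakk> \<Longrightarrow> skew_action d (g, x) = (g \<otimes>\<^bsub>G\<^esub> inv\<^bsub>G\<^esub> cocycle d x, b d x)"
  by (simp add: skew_action_def space_\<Omega>)

lemma measurable_\<Omega>I:
  assumes "\<And>g. g \<in> carrier G \<Longrightarrow> (\<lambda>x. f (g, x)) \<in> measurable M K"
  shows "f \<in> measurable \<Omega> K"
  unfolding \<Omega>_def using cG assms by (rule measurable_pair_measure_countable1)

lemma nn_integral_\<Omega>: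
  assumes "u \<in> borel_measurable \<Omega>"
  shows "(\<integral>\<^sup>+w. u w \<partial>\<Omega>) = (\<integral>\<^sup>+g. \<integral>\<^sup>+x. u (g, x) \<partial>M \<partial>count_space (carrier G))"
  using assms unfolding \<Omega>_def by (rule M.nn_integral_fst[symmetric])

lemma slice_measurable:
  assumes "u \<in> measurable \<Omega> K" "g \<in> carrier G"
  shows "(\<lambda>x. u (g, x)) \<in> measurable M K"
  using assms unfolding \<Omega>_def
  by (intro measurable_compose[OF _ assms(1)[unfolded \<Omega>_def]] measurable_Pair measurable_const measurable_ident) auto

lemma nn_integral_\<Omega>_swap:
  assumes "u \<in> borel_measurable \<Omega>"
  shows "(\<integral>\<^sup>+w. u w \<partial>\<Omega>) = (\<integral>\<^sup>+x. \<integral>\<^sup>+g. u (g, x) \<partial>count_space (carrier G) \<partial>M)"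
  unfolding nn_integral_\<Omega>[OF assms]
  using slice_measurable[OF assms] by (intro nn_integral_count_space_nn_integral[symmetric] cG)

lemma left_action_measurable:
  assumes h: "h \<in> carrier G"
  shows "left_action h \<in> measurable \<Omega> \<Omega>"
proof (rule measurable_\<Omega>I)
  fix g assume g: "g \<in> carrier G"
  have "(\<lambda>x. (h \<otimes>\<^bsub>G\<^esub> g, x)) \<in> measurable M \<Omega>"
    unfolding \<Omega>_def using g h by (intro measurable_Pair measurable_const measurable_ident) auto
  then show "(\<lambda>x. left_action h (g, x)) \<in> measurable M \<Omega>"
    using left_action_apply[OF g] by (subst measurable_cong[of M _ "\<lambda>x. (h \<otimes>\<^bsub>G\<^esub> g, x)"]) auto
qed

lemma skew_action_measurable:
  assumes d: "d \<in> carrier H"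
  shows "skew_action d \<in> measurable \<Omega> \<Omega>"
proof (rule measurable_\<Omega>I)
  fix g assume g: "g \<in> carrier G"
  have "(\<lambda>k. g \<otimes>\<^bsub>G\<^esub> inv\<^bsub>G\<^esub> k) \<in> measurable (count_space (carrier G)) (count_space (carrier G))"
    using g by auto
  then have "(\<lambda>x. (g \<otimes>\<^bsub>G\<^esub> inv\<^bsub>G\<^esub> cocycle d x, b d x)) \<in> measurable M \<Omega>"
    unfolding \<Omega>_def
    by (intro measurable_Pair measurable_compose[OF cocycle_measurable[OF d]] b_meas[OF d])
  then show "(\<lambda>x. skew_action d (g, x)) \<in> measurable M \<Omega>"
    using skew_action_apply[OF g]
    by (subst measurable_cong[of M _ "\<lambda>x. (g \<otimes>\<^bsub>G\<^esub> inv\<^bsub>G\<^esub> cocycle d x, b d x)"]) auto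
qed

lemma mp_action_left: "mp_action G \<Omega> left_action"
proof (rule mp_actionI)
  show "left_action (h \<otimes>\<^bsub>G\<^esub> k) w = left_action h (left_action k w)"
    if "h \<in> carrier G" "k \<in> carrier G" "w \<in> space \<Omega>" for h k w
    using that by (auto simp: space_\<Omega> left_action_apply G.m_assoc)
  fix h A assume h: "h \<in> carrier G" and A: "A \<in> sets \<Omega>"
  note [measurable] = left_action_measurable[OF h] A
  have bij: "bij_betw (\<lambda>g. h \<otimes>\<^bsub>G\<^esub> g) (carrier G) (carrier G)"
    using h by (intro bij_betwI[where g = "\<lambda>g. inv\<^bsub>G\<^esub> h \<otimes>\<^bsub>G\<^esub> g"]) (auto simp: G.m_assoc[symmetric])
  have "emeasure \<Omega> (left_action h -` A \<inter> space \<Omega>) = (\<integral>\<^sup>+w. indicator A (left_action h w) \<partial>\<Omega>)"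
    by (rule emeasure_vimage_eq_nn_integral[OF _ A]) measurable
  also have "\<dots> = (\<integral>\<^sup>+g. \<integral>\<^sup>+x. indicator A (h \<otimes>\<^bsub>G\<^esub> g, x) \<partial>M \<partial>count_space (carrier G))"
    by (subst nn_integral_\<Omega>) (auto intro!: nn_integral_cong simp: left_action_apply)
  also have "\<dots> = (\<integral>\<^sup>+g. \<integral>\<^sup>+x. indicator A (g, x) \<partial>M \<partial>count_space (carrier G))"
    by (rule nn_integral_bij_count_space[OF bij])
  also have "\<dots> = emeasure \<Omega> A"
    by (subst nn_integral_\<Omega>[symmetric]) auto
  finally show "emeasure \<Omega> (left_action h -` A \<inter> space \<Omega>) = emeasure \<Omega> A" .
next
  show "left_action h \<in> extensional (space \<Omega>)" for h by (simp add: left_action_def)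
qed (auto simp: G.is_group left_action_measurable left_action_apply space_\<Omega>)

text \<open>
  For fixed \<open>x\<close>, right translation by \<open>inv (cocycle d x)\<close> permutes \<open>G\<close> and disappears after summing over
  \<open>g\<close>; what is left is the invariance of \<open>M\<close> under \<open>b d\<close>.
\<close>

lemma mp_action_skew: "mp_action H \<Omega> skew_action"
proof (rule mp_actionI)
  show "skew_action (d \<otimes>\<^bsub>H\<^esub> e) w = skew_action d (skew_action e w)"
    if "d \<in> carrier H" "e \<in> carrier H" "w \<in> space \<Omega>" for d e w
    using that by (auto simp: space_\<Omega> skew_action_apply cocycle_mult cocycle_closed b_closed
        G.inv_mult_group G.m_assoc mp_action_mult[OF actH])
  fix d A assume d: "d \<in> carrier H" and A: "A \<in> sets \<Omega>"
  note [measurable] = skew_action_measurable[OF d] A b_meas[OF d]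
  have bij: "bij_betw (\<lambda>g. g \<otimes>\<^bsub>G\<^esub> k) (carrier G) (carrier G)" if "k \<in> carrier G" for k
    using that by (intro bij_betwI[where g = "\<lambda>g. g \<otimes>\<^bsub>G\<^esub> inv\<^bsub>G\<^esub> k"]) (auto simp: G.m_assoc)
  have "emeasure \<Omega> (skew_action d -` A \<inter> space \<Omega>) = (\<integral>\<^sup>+w. indicator A (skew_action d w) \<partial>\<Omega>)"
    by (rule emeasure_vimage_eq_nn_integral[OF _ A]) measurable
  also have "\<dots> = (\<integral>\<^sup>+x. \<integral>\<^sup>+g. indicator A (g \<otimes>\<^bsub>G\<^esub> inv\<^bsub>G\<^esub> cocycle d x, b d x) \<partial>count_space (carrier G) \<partial>M)"
    by (subst nn_integral_\<Omega>_swap) (auto intro!: nn_integral_cong simp: skew_action_apply)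
  also have "\<dots> = (\<integral>\<^sup>+x. \<integral>\<^sup>+g. indicator A (g, b d x) \<partial>count_space (carrier G) \<partial>M)"
    by (rule nn_integral_cong, rule nn_integral_bij_count_space[OF bij])
      (simp add: cocycle_closed[OF d])
  also have "\<dots> = (\<integral>\<^sup>+g. \<integral>\<^sup>+x. indicator A (g, b d x) \<partial>M \<partial>count_space (carrier G))"
    using slice_measurable[of "indicator A :: _ \<Rightarrow> ennreal" borel]
    by (intro nn_integral_count_space_nn_integral cG) (auto intro: measurable_compose[OF b_meas[OF d]])
  also have "\<dots> = (\<integral>\<^sup>+g. \<integral>\<^sup>+x. indicator A (g, x) \<partial>M \<partial>count_space (carrier G))"
    using slice_measurable[of "indicator A :: _ \<Rightarrow> ennreal" borel]
    by (intro nn_integral_cong mp_action_nn_integral[OF actH d]) auto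
  also have "\<dots> = emeasure \<Omega> A"
    by (subst nn_integral_\<Omega>[symmetric]) auto
  finally show "emeasure \<Omega> (skew_action d -` A \<inter> space \<Omega>) = emeasure \<Omega> A" .
next
  show "skew_action d \<in> extensional (space \<Omega>)" for d by (simp add: skew_action_def)
qed (auto simp: H.is_group skew_action_measurable skew_action_apply space_\<Omega>
    cocycle_one mp_action_one[OF actH])

lemma left_skew_commute:
  assumes "h \<in> carrier G" "d \<in> carrier H" "w \<in> space \<Omega>"
  shows "left_action h (skew_action d w) = skew_action d (left_action h w)"
  using assms by (auto simp: space_\<Omega> left_action_apply skew_action_apply cocycle_closed b_closed G.m_assoc)

lemma AE_\<Omega>: "AE w in \<Omega>. fst w \<in> carrier G \<and> snd w \<in> X\<^sub>0"
proof -
  have "AE w in \<Omega>. snd w \<in> X\<^sub>0"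
    unfolding \<Omega>_def
    by (rule GM.AE_pair_measure, measurable) (use X\<^sub>0_AE in \<open>auto simp: AE_count_space\<close>)
  with AE_space show ?thesis
    by eventually_elim (auto simp: space_\<Omega>)
qed

lemma emeasure_\<Omega>:
  assumes "A \<in> sets \<Omega>"
  shows "emeasure \<Omega> A = (\<integral>\<^sup>+g. emeasure M {x \<in> space M. (g, x) \<in> A} \<partial>count_space (carrier G))"
proof -
  have "Pair g -` A = {x \<in> space M. (g, x) \<in> A}" for g
    using sets.sets_into_space[OF assms] by (auto simp: space_\<Omega>)
  then show ?thesis
    using M.emeasure_pair_measure_alt[of A "count_space (carrier G)"] assms by (simp add: \<Omega>_def)
qed

lemma sets_\<Omega>I:
  assumes "A \<subseteq> carrier G \<times> space M" "\<And>g. g \<in> carrier G \<Longrightarrow> {x \<in> space M. (g, x) \<in> A} \<in> sets M"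
  shows "A \<in> sets \<Omega>"
proof -
  have "(\<lambda>w. w \<in> A) \<in> measurable \<Omega> (count_space UNIV)"
    using assms(2) by (intro measurable_\<Omega>I) (simp add: pred_def)
  then have "{w \<in> space \<Omega>. w \<in> A} \<in> sets \<Omega>" by (simp add: pred_def)
  also have "{w \<in> space \<Omega>. w \<in> A} = A" using assms(1) by (auto simp: space_\<Omega>)
  finally show ?thesis .
qed

definition left_domain :: "('g \<times> 'a) set" where
  "left_domain = {\<one>\<^bsub>G\<^esub>} \<times> space M"

lemma left_domain:
  "left_domain \<in> sets \<Omega>" "emeasure \<Omega> left_domain \<le> 1"
  "w \<in> space \<Omega> \<Longrightarrow> \<exists>!h. h \<in> carrier G \<and> left_action h w \<in> left_domain"
proof -
  show sets: "left_domain \<in> sets \<Omega>"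
    by (rule sets_\<Omega>I) (auto simp: left_domain_def)
  have "emeasure \<Omega> left_domain = (\<integral>\<^sup>+g. of_bool (g = \<one>\<^bsub>G\<^esub>) \<partial>count_space (carrier G))"
    unfolding emeasure_\<Omega>[OF sets]
    by (intro nn_integral_cong) (auto simp: left_domain_def M.emeasure_space_1)
  also have "\<dots> \<le> 1" by (rule nn_integral_count_space_le_1) simp
  finally show "emeasure \<Omega> left_domain \<le> 1" .
  show "\<exists>!h. h \<in> carrier G \<and> left_action h w \<in> left_domain" if w: "w \<in> space \<Omega>"
  proof -
    obtain g x where gx: "w = (g, x)" "g \<in> carrier G" "x \<in> space M"
      using w by (auto simp: space_\<Omega>)
    have "h \<otimes>\<^bsub>G\<^esub> g = \<one>\<^bsub>G\<^esub> \<longleftrightarrow> h = inv\<^bsub>G\<^esub> g" if "h \<in> carrier G" for h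
      using that gx(2) G.inv_equality[of h g] G.l_inv by auto
    then show ?thesis
      using gx by (intro ex1I[of _ "inv\<^bsub>G\<^esub> g"]) (auto simp: left_action_apply left_domain_def)
  qed
qed

abbreviation "rank_of \<equiv> to_nat_on (carrier G)"

definition skew_domain :: "('g \<times> 'a) set" where
  "skew_domain = {(g, x). g \<in> carrier G \<and> x \<in> space M \<and>
     (\<forall>d \<in> carrier H. rank_of g \<le> rank_of (g \<otimes>\<^bsub>G\<^esub> inv\<^bsub>G\<^esub> cocycle d x))}"

lemma skew_domain_sets: "skew_domain \<in> sets \<Omega>"
proof (rule sets_\<Omega>I)
  fix g assume g: "g \<in> carrier G"
  have "{x \<in> space M. rank_of g \<le> rank_of (g \<otimes>\<^bsub>G\<^esub> inv\<^bsub>G\<^esub> cocycle d x)} \<in> sets M"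
    if d: "d \<in> carrier H" for d
  proof -
    have "(\<lambda>x. rank_of (g \<otimes>\<^bsub>G\<^esub> inv\<^bsub>G\<^esub> cocycle d x)) \<in> measurable M (count_space UNIV)"
      by (rule measurable_compose[OF cocycle_measurable[OF d]]) simp
    then show ?thesis by measurable
  qed
  then have "{x \<in> space M. \<forall>d \<in> carrier H. rank_of g \<le> rank_of (g \<otimes>\<^bsub>G\<^esub> inv\<^bsub>G\<^esub> cocycle d x)} \<in> sets M"
    by (intro sets.sets_Collect_countable_All' cH)
  then show "{x \<in> space M. (g, x) \<in> skew_domain} \<in> sets M"
    using g by (simp add: skew_domain_def)
qed (auto simp: skew_domain_def)

text \<open>
  The first coordinate separates the points of an \<open>H\<close>-orbit over \<open>X\<^sub>0\<close>: equal first coordinates force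
  equal cocycle values, hence equal translates of \<open>x\<close>. So the minimum of the enumeration is attained at
  exactly one point.
\<close>

lemma skew_domain_ex1:
  assumes g: "g \<in> carrier G" and x: "x \<in> X\<^sub>0"
  shows "\<exists>!d. d \<in> carrier H \<and> skew_action d (g, x) \<in> skew_domain"
proof -
  note xM = X\<^sub>0_space[OF x]
  define m where "m d = rank_of (g \<otimes>\<^bsub>G\<^esub> inv\<^bsub>G\<^esub> cocycle d x)" for d
  have in_domain: "skew_action d (g, x) \<in> skew_domain \<longleftrightarrow> (\<forall>e \<in> carrier H. m d \<le> m e)"
    if d: "d \<in> carrier H" for d
  proof -
    have "g \<otimes>\<^bsub>G\<^esub> inv\<^bsub>G\<^esub> cocycle d x \<otimes>\<^bsub>G\<^esub> inv\<^bsub>G\<^esub> cocycle e (b d x)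
        = g \<otimes>\<^bsub>G\<^esub> inv\<^bsub>G\<^esub> cocycle (e \<otimes>\<^bsub>H\<^esub> d) x" if e: "e \<in> carrier H" for e
      using g d e by (simp add: cocycle_mult[OF e d xM] cocycle_closed G.inv_mult_group G.m_assoc)
    then have "skew_action d (g, x) \<in> skew_domain \<longleftrightarrow> (\<forall>e \<in> carrier H. m d \<le> m (e \<otimes>\<^bsub>H\<^esub> d))"
      using g d xM by (simp add: skew_action_apply skew_domain_def m_def cocycle_closed b_closed)
    also have "\<dots> \<longleftrightarrow> (\<forall>e \<in> carrier H. m d \<le> m e)"
    proof
      assume *: "\<forall>e \<in> carrier H. m d \<le> m (e \<otimes>\<^bsub>H\<^esub> d)"
      show "\<forall>e \<in> carrier H. m d \<le> m e"
      proof
        fix e assume "e \<in> carrier H"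
        then show "m d \<le> m e"
          using *[rule_format, of "e \<otimes>\<^bsub>H\<^esub> inv\<^bsub>H\<^esub> d"] d by (simp add: H.m_assoc)
      qed
    next
      assume *: "\<forall>e \<in> carrier H. m d \<le> m e"
      show "\<forall>e \<in> carrier H. m d \<le> m (e \<otimes>\<^bsub>H\<^esub> d)"
        using bspec[OF *] d by simp
    qed
    finally show ?thesis .
  qed
  obtain d where d: "d \<in> carrier H" "\<forall>e \<in> carrier H. m d \<le> m e"
    using ex_has_least_nat[of "\<lambda>d. d \<in> carrier H" "\<one>\<^bsub>H\<^esub>" m] by auto
  have unique: "e = d" if e: "e \<in> carrier H" "\<forall>k \<in> carrier H. m e \<le> m k" for e
  proof -
    have "m e = m d" using bspec[OF d(2) e(1)] bspec[OF e(2) d(1)] by simp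
    then have "g \<otimes>\<^bsub>G\<^esub> inv\<^bsub>G\<^esub> cocycle e x = g \<otimes>\<^bsub>G\<^esub> inv\<^bsub>G\<^esub> cocycle d x"
      using g cocycle_closed[OF d(1)] cocycle_closed[OF e(1)] by (simp add: m_def cG)
    then have "inv\<^bsub>G\<^esub> cocycle e x = inv\<^bsub>G\<^esub> cocycle d x"
      using g d(1) e(1) by (simp add: cocycle_closed G.Units_eq)
    then have "cocycle e x = cocycle d x"
      using G.inv_inv[OF cocycle_closed[OF e(1)]] G.inv_inv[OF cocycle_closed[OF d(1)]] by metis
    then have "b e x = b d x" using cocycle_act[OF x d(1)] cocycle_act[OF x e(1)] by simp
    then show ?thesis by (rule b_eqD[OF x e(1) d(1)])
  qed
  show ?thesis
  proof (rule ex1I[of _ d])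
    show "d \<in> carrier H \<and> skew_action d (g, x) \<in> skew_domain"
      using d by (simp add: in_domain)
    fix e assume "e \<in> carrier H \<and> skew_action e (g, x) \<in> skew_domain"
    then show "e = d" using unique in_domain by blast
  qed
qed

lemma AE_skew_domain: "AE w in \<Omega>. \<exists>!d. d \<in> carrier H \<and> skew_action d w \<in> skew_domain"
  using AE_\<Omega>
proof eventually_elim
  fix w assume "fst w \<in> carrier G \<and> snd w \<in> X\<^sub>0"
  then show "\<exists>!d. d \<in> carrier H \<and> skew_action d w \<in> skew_domain"
    using skew_domain_ex1[of "fst w" "snd w"] by simp
qed

text \<open>
  In terms of pairs \<open>(y, x)\<close>, the set \<open>related p q\<close> consists of those for which \<open>p y\<close> lies in the image under
  \<open>q\<close> of the \<open>H\<close>-orbit of \<open>x\<close>, and \<open>matched p q\<close> of those with \<open>p y = q x\<close>. With one of the two maps equal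
  to the identity they express \<open>S y E x\<close> and \<open>y \<in> S'([x]\<^sub>E)\<close>.
\<close>

definition related :: "('a \<Rightarrow> 'a) \<Rightarrow> ('a \<Rightarrow> 'a) \<Rightarrow> ('g \<times> 'a) set" where
  "related p q = {(g, x). g \<in> carrier G \<and> x \<in> X\<^sub>0 \<and> (\<exists>d \<in> carrier H. p (a g x) = q (b d x))}"

definition matched :: "('a \<Rightarrow> 'a) \<Rightarrow> ('a \<Rightarrow> 'a) \<Rightarrow> ('g \<times> 'a) set" where
  "matched p q = {(g, x). g \<in> carrier G \<and> x \<in> X\<^sub>0 \<and> p (a g x) = q x}"

lemma matched_sets:
  assumes p: "p \<in> measurable M M" and q: "q \<in> measurable M M"
  shows "matched p q \<in> sets \<Omega>"
proof (rule sets_\<Omega>I)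
  fix g assume g: "g \<in> carrier G"
  have [measurable]: "{x \<in> space M. p (a g x) = q x} \<in> sets M"
    using sb measurable_compose[OF a_meas[OF g] p] q by (rule standard_borel_equaliser_measurable)
  have "{x \<in> space M. (g, x) \<in> matched p q} = {x \<in> space M. p (a g x) = q x} \<inter> X\<^sub>0"
    using g by (auto simp: matched_def)
  also have "\<dots> \<in> sets M" by measurable
  finally show "{x \<in> space M. (g, x) \<in> matched p q} \<in> sets M" .
qed (auto simp: matched_def X\<^sub>0_space)

lemma related_sets:
  assumes p: "p \<in> measurable M M" and q: "q \<in> measurable M M"
  shows "related p q \<in> sets \<Omega>"
proof (rule sets_\<Omega>I)
  fix g assume g: "g \<in> carrier G"
  have "{x \<in> space M. p (a g x) = q (b d x)} \<in> sets M" if d: "d \<in> carrier H" for d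
    using sb measurable_compose[OF a_meas[OF g] p] measurable_compose[OF b_meas[OF d] q]
    by (rule standard_borel_equaliser_measurable)
  then have "(\<Union>d\<in>carrier H. {x \<in> space M. p (a g x) = q (b d x)}) \<inter> X\<^sub>0 \<in> sets M"
    by (intro sets.Int sets.countable_UN' cH) auto
  also have "(\<Union>d\<in>carrier H. {x \<in> space M. p (a g x) = q (b d x)}) \<inter> X\<^sub>0
      = {x \<in> space M. (g, x) \<in> related p q}"
    using g by (auto simp: related_def)
  finally show "{x \<in> space M. (g, x) \<in> related p q} \<in> sets M" .
qed (auto simp: related_def X\<^sub>0_space)

text \<open>
  The skew action moves \<open>x\<close> and leaves the other point \<open>a g x\<close> of the pair in place.
\<close>

lemma skew_action_same_target:
  assumes "g \<in> carrier G" "x \<in> X\<^sub>0" "d \<in> carrier H"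
  shows "a (g \<otimes>\<^bsub>G\<^esub> inv\<^bsub>G\<^esub> cocycle d x) (b d x) = a g x"
proof -
  have x: "x \<in> space M" and c: "cocycle d x \<in> carrier G"
    using assms by (auto intro: X\<^sub>0_space cocycle_closed)
  have "a (inv\<^bsub>G\<^esub> cocycle d x) (b d x) = x"
    using mp_action_inv_cancel(1)[OF actG c x] cocycle_act[OF assms(2,3)] by simp
  then show ?thesis
    using assms(1) c by (simp add: mp_action_mult[OF actG] b_closed[OF assms(3) x])
qed

lemma related_skew_invariant:
  assumes d: "d \<in> carrier H" and w: "w \<in> space \<Omega>"
  shows "skew_action d w \<in> related p q \<longleftrightarrow> w \<in> related p q"
proof -
  obtain g x where gx: "w = (g, x)" "g \<in> carrier G" "x \<in> space M"
    using w by (auto simp: space_\<Omega>)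
  show ?thesis
  proof (cases "x \<in> X\<^sub>0")
    case True
    have "(\<exists>e \<in> carrier H. y = q (b e (b d x))) \<longleftrightarrow> (\<exists>e \<in> carrier H. y = q (b e x))" for y
    proof
      assume "\<exists>e \<in> carrier H. y = q (b e (b d x))"
      then show "\<exists>e \<in> carrier H. y = q (b e x)"
        using d gx(3) by (metis H.m_closed mp_action_mult[OF actH])
    next
      assume "\<exists>e \<in> carrier H. y = q (b e x)"
      then obtain e where e: "e \<in> carrier H" "y = q (b e x)" by blast
      have "b (e \<otimes>\<^bsub>H\<^esub> inv\<^bsub>H\<^esub> d) (b d x) = b e x"
        using e(1) d gx(3) by (simp add: mp_action_mult[OF actH] b_closed mp_action_inv_cancel(1)[OF actH])
      then show "\<exists>e \<in> carrier H. y = q (b e (b d x))"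
        using e d by (intro bexI[of _ "e \<otimes>\<^bsub>H\<^esub> inv\<^bsub>H\<^esub> d"]) auto
    qed
    then show ?thesis
      using gx True d X\<^sub>0_inv[OF d gx(3)]
      by (simp add: skew_action_apply related_def skew_action_same_target cocycle_closed)
  next
    case False
    then show ?thesis
      using gx X\<^sub>0_inv[OF d gx(3)] by (simp add: skew_action_apply related_def)
  qed
qed

text \<open>
  So \<open>matched p q\<close> is a fundamental domain for \<open>H\<close> inside \<open>related p q\<close>.
\<close>

lemma matched_ex1:
  assumes q: "inj_on q (space M)" and w: "w \<in> related p q"
  shows "\<exists>!d. d \<in> carrier H \<and> skew_action d w \<in> matched p q"
proof -
  obtain g x d where gx: "w = (g, x)" "g \<in> carrier G" "x \<in> X\<^sub>0"
    and d: "d \<in> carrier H" "p (a g x) = q (b d x)"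
    using w by (auto simp: related_def)
  note xM = X\<^sub>0_space[OF gx(3)]
  have iff: "skew_action e w \<in> matched p q \<longleftrightarrow> p (a g x) = q (b e x)" if e: "e \<in> carrier H" for e
    using gx e xM X\<^sub>0_inv[OF e xM]
    by (simp add: skew_action_apply matched_def skew_action_same_target cocycle_closed)
  show ?thesis
  proof (rule ex1I[of _ d])
    fix e assume e: "e \<in> carrier H \<and> skew_action e w \<in> matched p q"
    then have "q (b e x) = q (b d x)" using iff d by metis
    then have "b e x = b d x" using q e d xM b_closed by (meson inj_onD)
    then show "e = d" using b_eqD[OF gx(3)] e d by blast
  qed (use d iff in auto)
qed

text \<open>
  Replacing the fundamental domain chosen by enumeration with the explicit one turns the covolume of a
  subset of \<open>related p q\<close> into a measure that can be computed.
\<close>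

lemma emeasure_related_skew_domain:
  assumes p: "p \<in> measurable M M" and q: "q \<in> measurable M M" and inj: "inj_on q (space M)"
    and V[measurable]: "V \<in> sets \<Omega>"
    and V_inv: "\<And>d w. \<lbrakk>d \<in> carrier H; w \<in> space \<Omega>\<rbrakk> \<Longrightarrow> skew_action d w \<in> V \<longleftrightarrow> w \<in> V"
  shows "emeasure \<Omega> (related p q \<inter> V \<inter> skew_domain) = emeasure \<Omega> (matched p q \<inter> V)"
proof -
  note [measurable] = related_sets[OF p q] matched_sets[OF p q] skew_domain_sets
  let ?u = "indicator (related p q \<inter> V) :: _ \<Rightarrow> ennreal"
  have sub: "matched p q \<subseteq> related p q"
    using mp_action_one[OF actH] X\<^sub>0_space by (force simp: matched_def related_def)
  have "(\<integral>\<^sup>+w. ?u w * indicator skew_domain w \<partial>\<Omega>) = (\<integral>\<^sup>+w. ?u w * indicator (matched p q) w \<partial>\<Omega>)"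
  proof (rule nn_integral_fundamental_domains_eq[OF mp_action_skew cH])
    show "AE w in \<Omega>. ?u (skew_action d w) = ?u w" if "d \<in> carrier H" for d
      using related_skew_invariant[OF that] V_inv[OF that] by (intro AE_I2) (simp add: indicator_def)
    show "AE w in \<Omega>. ?u w \<noteq> 0 \<longrightarrow> (\<exists>!d. d \<in> carrier H \<and> skew_action d w \<in> skew_domain)"
      using AE_skew_domain by eventually_elim simp
    show "AE w in \<Omega>. ?u w \<noteq> 0 \<longrightarrow> (\<exists>!d. d \<in> carrier H \<and> skew_action d w \<in> matched p q)"
      using matched_ex1[OF inj] by (intro AE_I2) (simp add: indicator_def)
  qed measurable
  moreover have "related p q \<inter> V \<inter> matched p q = matched p q \<inter> V" using sub by blast
  ultimately show ?thesis
    by (simp flip: indicator_inter_arith)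
qed

text \<open>
  In the coordinate \<open>z = a g x\<close> the condition reads \<open>p z = a (inv g) z\<close>, and for given \<open>z\<close> with \<open>p z \<in> X\<^sub>0\<close>
  freeness leaves at most one \<open>g\<close>.
\<close>

lemma emeasure_matched_id_right_le:
  assumes p: "p \<in> measurable M M"
  shows "emeasure \<Omega> (matched p (\<lambda>x. x)) \<le> 1"
proof -
  define C where "C g = {z \<in> space M. a (inv\<^bsub>G\<^esub> g) z \<in> X\<^sub>0 \<and> p z = a (inv\<^bsub>G\<^esub> g) z}" for g
  have C[measurable]: "C g \<in> sets M" if g: "g \<in> carrier G" for g
  proof -
    have [measurable]: "a (inv\<^bsub>G\<^esub> g) \<in> measurable M M" using g by (simp add: a_meas)
    have [measurable]: "{z \<in> space M. p z = a (inv\<^bsub>G\<^esub> g) z} \<in> sets M"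
      using sb p by (rule standard_borel_equaliser_measurable) measurable
    have "C g = {z \<in> space M. p z = a (inv\<^bsub>G\<^esub> g) z} \<inter> {z \<in> space M. a (inv\<^bsub>G\<^esub> g) z \<in> X\<^sub>0}"
      by (auto simp: C_def)
    also have "\<dots> \<in> sets M" by measurable
    finally show ?thesis .
  qed
  have sets: "matched p (\<lambda>x. x) \<in> sets \<Omega>" by (rule matched_sets[OF p]) simp
  have "emeasure M {x \<in> space M. (g, x) \<in> matched p (\<lambda>x. x)} = emeasure M (C g)"
    if g: "g \<in> carrier G" for g
  proof -
    let ?B = "{x \<in> space M. (g, x) \<in> matched p (\<lambda>x. x)}"
    have B: "?B \<in> sets M"
      using slice_measurable[of "\<lambda>w. w \<in> matched p (\<lambda>x. x)", OF _ g] sets by (simp add: pred_def)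
    have gi: "inv\<^bsub>G\<^esub> g \<in> carrier G" using g by simp
    have "C g = a (inv\<^bsub>G\<^esub> g) -` ?B \<inter> space M"
      using g a_closed[OF gi] mp_action_inv_cancel(2)[OF actG g] X\<^sub>0_space
      by (auto simp: C_def matched_def)
    also have "emeasure M \<dots> = emeasure M ?B"
      using emeasure_vimage_eq_nn_integral[OF a_meas[OF gi] B] mp_action_nn_integral[OF actG gi, of "indicator ?B"] B
      by simp
    finally show ?thesis by simp
  qed
  then have "emeasure \<Omega> (matched p (\<lambda>x. x)) = (\<integral>\<^sup>+g. \<integral>\<^sup>+z. indicator (C g) z \<partial>M \<partial>count_space (carrier G))"
    unfolding emeasure_\<Omega>[OF sets] by (intro nn_integral_cong) simp
  also have "\<dots> = (\<integral>\<^sup>+z. \<integral>\<^sup>+g. indicator (C g) z \<partial>count_space (carrier G) \<partial>M)"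
    by (intro nn_integral_count_space_nn_integral[symmetric] cG) simp
  also have "\<dots> \<le> (\<integral>\<^sup>+z. 1 \<partial>M)"
  proof (rule nn_integral_mono)
    fix z assume z: "z \<in> space M"
    have "(\<integral>\<^sup>+g. of_bool (z \<in> C g) \<partial>count_space (carrier G)) \<le> 1"
    proof (rule nn_integral_count_space_le_1)
      fix g h assume gh: "g \<in> carrier G" "h \<in> carrier G" "z \<in> C g" "z \<in> C h"
      have "p z \<in> X\<^sub>0" "a k (p z) = z" if "k \<in> carrier G" "z \<in> C k" for k
        using mp_action_inv_cancel(2)[OF actG that(1) z] that(2) by (simp_all add: C_def)
      from this[OF gh(1,3)] this[OF gh(2,4)] show "g = h"
        using a_eqD[OF _ gh(1,2)] by simp
    qed
    then show "(\<integral>\<^sup>+g. indicator (C g) z \<partial>count_space (carrier G)) \<le> 1"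
      by (simp add: indicator_def)
  qed
  also have "\<dots> = 1" by (simp add: M.emeasure_space_1)
  finally show ?thesis .
qed

lemma emeasure_matched_id_left_le:
  assumes q: "q \<in> measurable M M"
  shows "emeasure \<Omega> (matched (\<lambda>x. x) q) \<le> 1"
proof -
  have sets[measurable]: "matched (\<lambda>x. x) q \<in> sets \<Omega>" by (rule matched_sets[OF _ q]) simp
  have "emeasure \<Omega> (matched (\<lambda>x. x) q) = (\<integral>\<^sup>+w. indicator (matched (\<lambda>x. x) q) w \<partial>\<Omega>)" by simp
  also have "\<dots> = (\<integral>\<^sup>+x. \<integral>\<^sup>+g. indicator (matched (\<lambda>x. x) q) (g, x) \<partial>count_space (carrier G) \<partial>M)"
    by (rule nn_integral_\<Omega>_swap) measurable
  also have "\<dots> \<le> (\<integral>\<^sup>+x. 1 \<partial>M)"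
  proof (rule nn_integral_mono)
    fix x
    have "(\<integral>\<^sup>+g. of_bool ((g, x) \<in> matched (\<lambda>x. x) q) \<partial>count_space (carrier G)) \<le> 1"
    proof (rule nn_integral_count_space_le_1)
      fix g h assume "g \<in> carrier G" "h \<in> carrier G"
        "(g, x) \<in> matched (\<lambda>x. x) q" "(h, x) \<in> matched (\<lambda>x. x) q"
      then show "g = h" using a_eqD[of x g h] by (simp add: matched_def)
    qed
    then show "(\<integral>\<^sup>+g. indicator (matched (\<lambda>x. x) q) (g, x) \<partial>count_space (carrier G)) \<le> 1"
      by (simp add: indicator_def)
  qed
  also have "\<dots> = 1" by (simp add: M.emeasure_space_1)
  finally show ?thesis .
qed

text \<open>
  The element \<open>g\<close> with \<open>a g x = S' x\<close> turns \<open>x\<close> into a point \<open>(g, x)\<close> of \<open>matched id S'\<close>, and its translate by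
  \<open>h\<close> represents the pair \<open>(h S' x, x)\<close>; that one lies in \<open>related S id\<close> exactly if \<open>S h S' x\<close> and \<open>x\<close>
  are in the same \<open>H\<close>-orbit.
\<close>

lemma phi_le_emeasure:
  assumes S: "S \<in> measurable M M" and S': "S' \<in> measurable M M"
    and orb: "AE x in M. \<exists>g \<in> carrier G. a g x = S' x" and h: "h \<in> carrier G"
  shows "ennreal (phi M (orbit_rel H M b) (S \<circ> a h \<circ> S'))
    \<le> emeasure \<Omega> (matched (\<lambda>x. x) S' \<inter> {w \<in> space \<Omega>. left_action h w \<in> related S (\<lambda>x. x)})"
proof -
  let ?V = "matched (\<lambda>x. x) S' \<inter> {w \<in> space \<Omega>. left_action h w \<in> related S (\<lambda>x. x)}"
  let ?T = "S \<circ> a h \<circ> S'"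
  let ?Q = "{x \<in> space M. (?T x, x) \<in> orbit_rel H M b}"
  have T: "?T \<in> measurable M M"
    using S S' a_meas[OF h] by (intro measurable_comp)
  have [measurable]: "matched (\<lambda>x. x) S' \<in> sets \<Omega>" "related S (\<lambda>x. x) \<in> sets \<Omega>"
    "left_action h \<in> measurable \<Omega> \<Omega>"
    using matched_sets[OF _ S'] related_sets[OF S] left_action_measurable[OF h] by auto
  have V[measurable]: "?V \<in> sets \<Omega>" by measurable
  have Q_eq: "?Q = (\<Union>d\<in>carrier H. {x \<in> space M. x = b d (?T x)})"
    using measurable_space[OF T] by (auto simp: orbit_rel_def orbit_def)
  have "{x \<in> space M. x = b d (?T x)} \<in> sets M" if "d \<in> carrier H" for d
    using sb measurable_ident_sets[OF refl] measurable_compose[OF T b_meas[OF that]]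
    by (rule standard_borel_equaliser_measurable)
  then have Q[measurable]: "?Q \<in> sets M"
    unfolding Q_eq by (intro sets.countable_UN' cH) auto
  have "ennreal (phi M (orbit_rel H M b) ?T) = (\<integral>\<^sup>+x. indicator ?Q x \<partial>M)"
    unfolding phi_def nn_integral_indicator[OF Q] M.emeasure_eq_measure ..
  also have "\<dots> \<le> (\<integral>\<^sup>+x. \<integral>\<^sup>+g. indicator ?V (g, x) \<partial>count_space (carrier G) \<partial>M)"
  proof (rule nn_integral_mono_AE, use orb X\<^sub>0_AE in eventually_elim)
    fix x assume ex: "\<exists>g \<in> carrier G. a g x = S' x" and x: "x \<in> X\<^sub>0"
    show "indicator ?Q x \<le> (\<integral>\<^sup>+g. indicator ?V (g, x) \<partial>count_space (carrier G))"
    proof (cases "x \<in> ?Q")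
      case True
      note xM = X\<^sub>0_space[OF x]
      obtain g where g: "g \<in> carrier G" "a g x = S' x" using ex by blast
      obtain d where d: "d \<in> carrier H" "x = b d (?T x)"
        using True unfolding Q_eq by blast
      have "b (inv\<^bsub>H\<^esub> d) x = ?T x"
        using mp_action_inv_cancel(1)[OF actH d(1) measurable_space[OF T xM]] d(2) by simp
      then have "S (a (h \<otimes>\<^bsub>G\<^esub> g) x) = b (inv\<^bsub>H\<^esub> d) x"
        using g mp_action_mult[OF actG h g(1) xM] by simp
      then have "(g, x) \<in> ?V"
        using g x xM h d(1) by (auto simp: matched_def related_def left_action_apply space_\<Omega>)
      moreover have "k = g" if "k \<in> carrier G" "(k, x) \<in> ?V" for k
        using that g a_eqD[OF x that(1) g(1)] by (simp add: matched_def)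
      ultimately have "\<exists>!k. k \<in> carrier G \<and> (k, x) \<in> ?V"
        using g(1) by blast
      then show ?thesis
        using nn_integral_count_space_ex1[of "carrier G" "\<lambda>k. (k, x)" ?V] True by simp
    qed simp
  qed
  also have "\<dots> = (\<integral>\<^sup>+w. indicator ?V w \<partial>\<Omega>)"
    by (rule nn_integral_\<Omega>_swap[symmetric]) measurable
  also have "\<dots> = emeasure \<Omega> ?V" by simp
  finally show ?thesis .
qed

lemma measure_equivalent_if_phi_bounded_below:
  assumes S: "S \<in> measurable M M" and S': "S' \<in> measurable M M" and inj: "inj_on S' (space M)"
    and orb: "AE x in M. \<exists>g \<in> carrier G. a g x = S' x"
    and c: "0 < c" "\<And>h. h \<in> carrier G \<Longrightarrow> c \<le> phi M (orbit_rel H M b) (S \<circ> a h \<circ> S')"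
  shows "measure_equivalent G H"
proof -
  note [measurable] = skew_domain_sets
  let ?A = "related S (\<lambda>x. x)" and ?B = "related (\<lambda>x. x) S'"
  have A[measurable]: "?A \<in> sets \<Omega>" and B[measurable]: "?B \<in> sets \<Omega>"
    using related_sets[OF S] related_sets[OF _ S'] by auto
  note [measurable] = matched_sets[OF S measurable_ident_sets[OF refl]]
    matched_sets[OF measurable_ident_sets[OF refl] S']
  have finA: "emeasure \<Omega> (?A \<inter> skew_domain) < \<infinity>"
  proof -
    have "emeasure \<Omega> (?A \<inter> space \<Omega> \<inter> skew_domain) = emeasure \<Omega> (matched S (\<lambda>x. x) \<inter> space \<Omega>)"
      using mp_action_closed[OF mp_action_skew] by (intro emeasure_related_skew_domain S) auto
    also have "\<dots> \<le> emeasure \<Omega> (matched S (\<lambda>x. x))" by (intro emeasure_mono) auto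
    also have "\<dots> \<le> 1" using S by (rule emeasure_matched_id_right_le)
    finally show ?thesis
      using sets.sets_into_space[OF A] by (auto simp: Int_absorb2 intro: le_less_trans)
  qed
  have finB: "emeasure \<Omega> (?B \<inter> skew_domain) < \<infinity>"
  proof -
    have "emeasure \<Omega> (?B \<inter> space \<Omega> \<inter> skew_domain) = emeasure \<Omega> (matched (\<lambda>x. x) S' \<inter> space \<Omega>)"
      using mp_action_closed[OF mp_action_skew] by (intro emeasure_related_skew_domain S' inj) auto
    also have "\<dots> \<le> emeasure \<Omega> (matched (\<lambda>x. x) S')" by (intro emeasure_mono) auto
    also have "\<dots> \<le> 1" using S' by (rule emeasure_matched_id_left_le)
    finally show ?thesis
      using sets.sets_into_space[OF B] by (auto simp: Int_absorb2 intro: le_less_trans)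
  qed
  have overlap: "ennreal c \<le> emeasure \<Omega> {w \<in> space \<Omega>. left_action h w \<in> ?A \<and> w \<in> ?B \<and> w \<in> skew_domain}"
    if h: "h \<in> carrier G" for h
  proof -
    let ?V = "{w \<in> space \<Omega>. left_action h w \<in> ?A}"
    note [measurable] = left_action_measurable[OF h]
    have V: "?V \<in> sets \<Omega>" by measurable
    have V_inv: "skew_action d w \<in> ?V \<longleftrightarrow> w \<in> ?V" if d: "d \<in> carrier H" and w: "w \<in> space \<Omega>" for d w
      using left_skew_commute[OF h d w] related_skew_invariant[OF d mp_action_closed[OF mp_action_left h w]]
        mp_action_closed[OF mp_action_skew d w] w by simp
    have "ennreal c \<le> ennreal (phi M (orbit_rel H M b) (S \<circ> a h \<circ> S'))"
      using c(2)[OF h] by (rule ennreal_leI)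
    also have "\<dots> \<le> emeasure \<Omega> (matched (\<lambda>x. x) S' \<inter> ?V)"
      by (rule phi_le_emeasure[OF S S' orb h])
    also have "\<dots> = emeasure \<Omega> (?B \<inter> ?V \<inter> skew_domain)"
      by (rule emeasure_related_skew_domain[OF _ S' inj V V_inv, symmetric]) auto
    also have "?B \<inter> ?V \<inter> skew_domain = {w \<in> space \<Omega>. left_action h w \<in> ?A \<and> w \<in> ?B \<and> w \<in> skew_domain}"
      by auto
    finally show ?thesis .
  qed
  have "\<exists>V \<in> sets \<Omega>. (\<forall>h \<in> carrier G. AE w in \<Omega>. left_action h w \<in> V \<longleftrightarrow> w \<in> V) \<and>
    (\<forall>d \<in> carrier H. \<forall>w \<in> space \<Omega>. skew_action d w \<in> V \<longleftrightarrow> w \<in> V) \<and>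
    emeasure \<Omega> V \<noteq> 0 \<and> emeasure \<Omega> (V \<inter> skew_domain) < \<infinity>"
    by (rule invariant_set_of_finite_covolume[OF mp_action_left mp_action_skew cH left_skew_commute
          skew_domain_sets A B AE_skew_domain related_skew_invariant finA finB c(1) overlap])
  then obtain V where V: "V \<in> sets \<Omega>"
    and V_left: "\<forall>h \<in> carrier G. AE w in \<Omega>. left_action h w \<in> V \<longleftrightarrow> w \<in> V"
    and V_skew: "\<forall>d \<in> carrier H. \<forall>w \<in> space \<Omega>. skew_action d w \<in> V \<longleftrightarrow> w \<in> V"
    and V_pos: "emeasure \<Omega> V \<noteq> 0" and V_fin: "emeasure \<Omega> (V \<inter> skew_domain) < \<infinity>"
    by (elim bexE conjE) (rule that)
  note [measurable] = V
  let ?W = "density \<Omega> (indicator V)"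
  have W: "emeasure ?W X = emeasure \<Omega> (V \<inter> X)" if "X \<in> sets \<Omega>" for X
    using that by (subst emeasure_density) (auto simp flip: indicator_inter_arith)
  have AE_W: "AE w in ?W. P w" if "AE w in \<Omega>. P w" for P
    using that by (subst AE_density) auto
  show ?thesis
  proof (rule measure_equivalentI[where W = ?W and a = left_action and b = skew_action])
    have "standard_borel \<Omega>"
      unfolding \<Omega>_def using sb cG by (rule standard_borel_count_space_pair)
    then show "standard_borel ?W" by (simp add: standard_borel_def)
    have "sigma_finite_measure \<Omega>" unfolding \<Omega>_def by (rule GM.sigma_finite_measure_axioms)
    then show "sigma_finite_measure ?W"
      by (subst sigma_finite_measure.sigma_finite_iff_density_finite) (auto simp: indicator_def)
    show "emeasure ?W (space ?W) \<noteq> 0"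
      using V_pos sets.sets_into_space[OF V] by (simp add: W Int_absorb2)
    show "mp_action G ?W left_action"
      by (rule mp_action_density_indicator[OF mp_action_left V bspec[OF V_left]])
    show "mp_action H ?W skew_action"
      by (rule mp_action_density_indicator[OF mp_action_skew V]) (simp add: V_skew)
    show "free_action G ?W left_action"
      unfolding free_action_def
    proof (rule AE_W, use AE_space in eventually_elim)
      fix w assume "w \<in> space \<Omega>"
      then obtain g x where "w = (g, x)" "g \<in> carrier G" "x \<in> space M" by (auto simp: space_\<Omega>)
      then show "stabilizer G left_action w = {\<one>\<^bsub>G\<^esub>}"
        by (auto simp: stabilizer_def left_action_apply)
    qed
    show "free_action H ?W skew_action"
      unfolding free_action_def
    proof (rule AE_W, use AE_\<Omega> in eventually_elim)
      fix w assume "fst w \<in> carrier G \<and> snd w \<in> X\<^sub>0"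
      then obtain g x where w: "w = (g, x)" "g \<in> carrier G" "x \<in> X\<^sub>0" by (cases w) auto
      have "stabilizer H skew_action w \<subseteq> stabilizer H b x"
        using w X\<^sub>0_space by (auto simp: stabilizer_def skew_action_apply)
      moreover have "\<one>\<^bsub>H\<^esub> \<in> stabilizer H skew_action w"
        using mp_action_one[OF mp_action_skew, of w] w X\<^sub>0_space by (simp add: stabilizer_def space_\<Omega>)
      ultimately show "stabilizer H skew_action w = {\<one>\<^bsub>H\<^esub>}"
        using freeH[OF w(3)] by blast
    qed
    show "left_action h (skew_action d w) = skew_action d (left_action h w)"
      if "h \<in> carrier G" "d \<in> carrier H" "w \<in> space ?W" for h d w
      using that by (simp add: left_skew_commute)
    show "fundamental_domain G ?W left_action left_domain"
      using left_domain by (intro fundamental_domainI AE_W AE_I2) auto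
    show "fundamental_domain H ?W skew_action skew_domain"
      using skew_domain_sets AE_skew_domain by (intro fundamental_domainI AE_W) auto
    have "emeasure ?W left_domain \<le> emeasure \<Omega> left_domain"
      unfolding W[OF left_domain(1)] by (intro emeasure_mono left_domain(1)) auto
    also have "\<dots> \<le> 1" by (rule left_domain(2))
    finally show "emeasure ?W left_domain < \<infinity>" by (auto intro: le_less_trans)
    show "emeasure ?W skew_domain < \<infinity>"
      using V_fin by (simp add: W)
  qed
qed

end

theorem corollary2p9:
  fixes G :: "('g, 'm) monoid_scheme" and H :: "('h, 'n) monoid_scheme"
    and M :: "'a measure"
    and a :: "'g \<Rightarrow> 'a \<Rightarrow> 'a" and b :: "'h \<Rightarrow> 'a \<Rightarrow> 'a"
    and S S' :: "'a \<Rightarrow> 'a"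
  assumes "group G" and "countable (carrier G)"
    and "group H" and "countable (carrier H)"
    and "standard_borel M" and "prob_space M"
    and "mp_action G M a" and "free_action G M a"
    and "mp_action H M b" and "free_action H M b"
    and "ae_subrel M (orbit_rel H M b) (orbit_rel G M a)"
    and "S \<in> full_group M (orbit_rel G M a)" and "S' \<in> full_group M (orbit_rel G M a)"
    and "(INF g\<in>carrier G. phi M (orbit_rel H M b) (S \<circ> a g \<circ> S')) > 0"
  shows "measure_equivalent G H"
proof -
  note actG = assms(7) and actH = assms(9) and cH = assms(4)
  interpret H: group H by fact
  define good where "good x \<longleftrightarrow> stabilizer G a x = {\<one>\<^bsub>G\<^esub>} \<and> stabilizer H b x = {\<one>\<^bsub>H\<^esub>}
     \<and> orbit H b x \<subseteq> orbit G a x" for x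
  have "AE x in M. good x"
    using assms(8,10,11) AE_space unfolding free_action_def ae_subrel_def
    by eventually_elim (auto simp: good_def orbit_rel_def)
  then obtain N where N: "{x \<in> space M. \<not> good x} \<subseteq> N" "emeasure M N = 0" and N_sets[measurable]: "N \<in> sets M"
    by (rule AE_E)
  \<comment> \<open>discarding all orbits that meet \<open>N\<close> makes the conull set invariant\<close>
  define X\<^sub>0 where "X\<^sub>0 = {x \<in> space M. \<forall>d \<in> carrier H. b d x \<notin> N}"
  have X\<^sub>0_good: "good x" if "x \<in> X\<^sub>0" for x
  proof -
    have "x \<in> space M" "b \<one>\<^bsub>H\<^esub> x \<notin> N" using that by (auto simp: X\<^sub>0_def)
    then show ?thesis using N(1) mp_action_one[OF actH] by auto
  qed
  have "nested_actions G H M a b X\<^sub>0"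
  proof (rule nested_actions.intro)
    have "{x \<in> space M. b d x \<notin> N} \<in> sets M" if "d \<in> carrier H" for d
      using mp_action_measurable[OF actH that] by measurable
    then show "X\<^sub>0 \<in> sets M"
      unfolding X\<^sub>0_def by (intro sets.sets_Collect_countable_All' cH)
    have "AE x in M. x \<notin> N" using N(2) by (intro AE_not_in) auto
    then have "AE x in M. \<forall>d \<in> carrier H. b d x \<notin> N"
      using cH mp_action_AE[OF actH, of _ "\<lambda>x. x \<notin> N"] by (simp add: AE_ball_countable)
    then show "AE x in M. x \<in> X\<^sub>0"
      using AE_space by eventually_elim (simp add: X\<^sub>0_def)
    show "b d x \<in> X\<^sub>0 \<longleftrightarrow> x \<in> X\<^sub>0" if d: "d \<in> carrier H" and x: "x \<in> space M" for d x
    proof -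
      have *: "b e (b d x) = b (e \<otimes>\<^bsub>H\<^esub> d) x" if "e \<in> carrier H" for e
        using mp_action_mult[OF actH that d x] by simp
      have "b e x = b (e \<otimes>\<^bsub>H\<^esub> inv\<^bsub>H\<^esub> d) (b d x)" if "e \<in> carrier H" for e
        using *[of "e \<otimes>\<^bsub>H\<^esub> inv\<^bsub>H\<^esub> d"] that d by (simp add: H.m_assoc)
      then have "(\<forall>e \<in> carrier H. b e (b d x) \<notin> N) \<longleftrightarrow> (\<forall>e \<in> carrier H. b e x \<notin> N)"
        using * d by (metis H.inv_closed H.m_closed)
      then show ?thesis
        using x mp_action_closed[OF actH d x] by (simp add: X\<^sub>0_def)
    qed
    show "stabilizer G a x = {\<one>\<^bsub>G\<^esub>}" "stabilizer H b x = {\<one>\<^bsub>H\<^esub>}" "orbit H b x \<subseteq> orbit G a x"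
      if "x \<in> X\<^sub>0" for x
      using X\<^sub>0_good[OF that] by (simp_all add: good_def)
  qed (rule assms)+
  then interpret nested_actions G H M a b X\<^sub>0 .
  have S: "S \<in> measurable M M" and S': "S' \<in> measurable M M" and inj: "inj_on S' (space M)"
    using assms(12,13) by (auto simp: full_group_def aut_def bij_betw_def)
  have orb: "AE x in M. \<exists>g \<in> carrier G. a g x = S' x"
  proof -
    have "AE x in M. (S' x, x) \<in> orbit_rel G M a"
      using assms(13) by (simp add: full_group_def)
    then show ?thesis
    proof eventually_elim
      fix x assume "(S' x, x) \<in> orbit_rel G M a"
      then obtain g where "g \<in> carrier G" "S' x \<in> space M" "a g (S' x) = x"
        by (auto simp: orbit_rel_def orbit_def)
      then show "\<exists>g \<in> carrier G. a g x = S' x"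
        using mp_action_inv_cancel(1)[OF actG, of g "S' x"] by (intro bexI[of _ "inv\<^bsub>G\<^esub> g"]) auto
    qed
  qed
  let ?c = "INF g\<in>carrier G. phi M (orbit_rel H M b) (S \<circ> a g \<circ> S')"
  have "?c \<le> phi M (orbit_rel H M b) (S \<circ> a h \<circ> S')" if "h \<in> carrier G" for h
    using that by (intro cINF_lower bdd_belowI2[of _ 0]) (auto simp: phi_def)
  then show ?thesis
    by (rule measure_equivalent_if_phi_bounded_below[OF S S' inj orb assms(14)])
qed

end
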